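(* Let $k$ be an algebraically closed field of characteristic zero, $G$ a group, $a\in Z(G)$, $\chi\in\hat G$ with $\chi(a)\neq 1$, and $H=kG(\chi^{-1},a,0)$. Assume that $|\chi|=s<\infty$ and that $q=\chi^{-1}(a)$ is a primitive $s$-th root of unity. Let $p,t\geq 1$ be integers, $\sigma,\lambda\in\hat G$ and $\alpha,\beta\in k^\times$. Then there is an isomorphism of $H$-modules $$V_p(\sigma,\alpha)\otimes V_t(\lambda,\beta)\cong\bigoplus_{i=0}^{s-1}\bigoplus_{j=1}^{\min\{p,t\}}V_{2j-1+|p-t|}(\chi^i\sigma\lambda,\ \alpha\lambda^s(a)+\beta).$$
   Context: $Z(G)$ is the center of $G$; $\hat G$ is the group (under pointwise product) of characters, i.e. group homomorphisms $G\to k^\times=k\setminus\{0\}$; $|\chi|$ is the order of $\chi$ in $\hat G$; $\lambda^s(a)=\lambda(a)^s$. The Hopf algebra $H=kG(\chi^{-1},a,0)$ is generated as a $k$-algebra by the group algebra $kG$ and an element $x$ subject to $xg=\chi^{-1}(g)gx$ for $g\in G$; it has $k$-basis $\{gx^i\mid g\in G,\ i\geq 0\}$. Its coalgebra structure and antipode are given by $\Delta(x)=x\otimes a+1\otimes x$, $\varepsilon(x)=0$, $S(x)=-xa^{-1}$, $\Delta(g)=g\otimes g$, $\varepsilon(g)=1$, $S(g)=g^{-1}$ for $g\in G$. Modules are left modules, $\otimes=\otimes_k$, and $H$ acts on a tensor product of modules via $\Delta$. With $|\chi|=s<\infty$, for $\lambda\in\hat G$, $\beta\in k$ (possibly $\beta=0$)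 and an integer $n\geq 1$, write $(y-\beta)^n=y^n-\sum_{j=0}^{n-1}\alpha_jy^j$ in $k[y]$; then $V_n(\lambda,\beta)$ is the $ns$-dimensional $H$-module with $k$-basis $m_0,\dots,m_{ns-1}$ and action $g\cdot m_i=\chi^i(g)\lambda(g)m_i$ for $g\in G$, $0\leq i\leq ns-1$; $x\cdot m_i=m_{i+1}$ for $0\leq i\leq ns-2$; $x\cdot m_{ns-1}=\sum_{j=0}^{n-1}\alpha_jm_{js}$. (In particular, on $V_n(\lambda,0)$ one has $x\cdot m_{ns-1}=0$.) *)

theory Defs
  imports "HOL-Algebra.Multiplicative_Group" "HOL-Library.Poly_Mapping"
    "HOL-Computational_Algebra.Polynomial"
begin

section \<open>Characters\<close>

definition center :: "('g, 'm) monoid_scheme \<Rightarrow> 'g set" where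
  "center G = {a \<in> carrier G. \<forall>g\<in>carrier G. a \<otimes>\<^bsub>G\<^esub> g = g \<otimes>\<^bsub>G\<^esub> a}"

definition unit_group :: "'k::field monoid" where
  "unit_group = \<lparr>carrier = UNIV - {0}, monoid.mult = (*), one = 1\<rparr>"

text \<open>Characters are made extensional (\<^const>\<open>undefined\<close> outside the carrier), so that equality
  of characters is equality of functions and the order of a character is its
  \<^const>\<open>group.ord\<close>.\<close>

definition character_group :: "('g, 'm) monoid_scheme \<Rightarrow> ('g \<Rightarrow> 'k::field) monoid" where
  "character_group G =
     \<lparr>carrier = hom G unit_group \<inter> extensional (carrier G),
      monoid.mult = (\<lambda>\<chi> \<psi>. \<lambda>g\<in>carrier G. \<chi> g * \<psi> g),
      one = (\<lambda>g\<in>carrier G. 1)\<rparr>"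

definition primitive_root_of_unity :: "nat \<Rightarrow> 'k::field \<Rightarrow> bool" where
  "primitive_root_of_unity s q \<longleftrightarrow> s > 0 \<and> q ^ s = 1 \<and> (\<forall>m. 0 < m \<and> m < s \<longrightarrow> q ^ m \<noteq> 1)"


section \<open>Vector spaces with a basis\<close>

text \<open>The vector space with basis \<open>B\<close> is the space of finitely supported functions
  with support in \<open>B\<close>, the basis vector of \<open>b \<in> B\<close> being \<open>Poly_Mapping.single b 1\<close>.
  The tensor product of the spaces with bases \<open>B\<close> and \<open>C\<close> is then the space with
  basis \<open>B \<times> C\<close>.\<close>

definition scale :: "'k::field \<Rightarrow> ('b \<Rightarrow>\<^sub>0 'k) \<Rightarrow> ('b \<Rightarrow>\<^sub>0 'k)" where
  "scale c u = Poly_Mapping.map ((*) c) u"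

definition lin :: "('b \<Rightarrow> ('c \<Rightarrow>\<^sub>0 'k::field)) \<Rightarrow> ('b \<Rightarrow>\<^sub>0 'k) \<Rightarrow> ('c \<Rightarrow>\<^sub>0 'k)" where
  "lin f u = (\<Sum>b\<in>Poly_Mapping.keys u. scale (Poly_Mapping.lookup u b) (f b))"

definition bilin ::
  "('a \<Rightarrow> 'b \<Rightarrow> ('c \<Rightarrow>\<^sub>0 'k::field)) \<Rightarrow> ('a \<Rightarrow>\<^sub>0 'k) \<Rightarrow> ('b \<Rightarrow>\<^sub>0 'k) \<Rightarrow> ('c \<Rightarrow>\<^sub>0 'k)" where
  "bilin f u v = lin (\<lambda>a. lin (f a) v) u"

definition tensor :: "('a \<Rightarrow>\<^sub>0 'k::field) \<Rightarrow> ('b \<Rightarrow>\<^sub>0 'k) \<Rightarrow> ('a \<times> 'b \<Rightarrow>\<^sub>0 'k)" where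
  "tensor = bilin (\<lambda>a b. Poly_Mapping.single (a, b) 1)"

definition based_algebra ::
  "'b set \<Rightarrow> ('b \<Rightarrow> 'b \<Rightarrow> ('b \<Rightarrow>\<^sub>0 'k::field)) \<Rightarrow> ('b \<Rightarrow>\<^sub>0 'k) \<Rightarrow> ('b \<Rightarrow>\<^sub>0 'k) ring" where
  "based_algebra B m e =
     \<lparr>carrier = {u. Poly_Mapping.keys u \<subseteq> B}, monoid.mult = bilin m, one = e, zero = 0, add = (+)\<rparr>"


section \<open>The Hopf algebra $kG(\eta, a, 0)$\<close>

text \<open>The pair \<open>(g, i)\<close> stands for the basis element $g x^i$. The relation $x g = \eta(g) g x$
  gives $(g x^i)(h x^j) = \eta(h)^i\, gh\, x^{i+j}$.\<close>

definition H_basis_mult ::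
  "('g, 'm) monoid_scheme \<Rightarrow> ('g \<Rightarrow> 'k::field) \<Rightarrow> 'g \<times> nat \<Rightarrow> 'g \<times> nat \<Rightarrow> ('g \<times> nat \<Rightarrow>\<^sub>0 'k)" where
  "H_basis_mult G \<eta> = (\<lambda>(g, i) (h, j). Poly_Mapping.single (g \<otimes>\<^bsub>G\<^esub> h, i + j) (\<eta> h ^ i))"

definition H_alg ::
  "('g, 'm) monoid_scheme \<Rightarrow> ('g \<Rightarrow> 'k::field) \<Rightarrow> ('g \<times> nat \<Rightarrow>\<^sub>0 'k) ring" where
  "H_alg G \<eta> = based_algebra (carrier G \<times> UNIV) (H_basis_mult G \<eta>) (Poly_Mapping.single (\<one>\<^bsub>G\<^esub>, 0) 1)"

definition HH_alg ::
  "('g, 'm) monoid_scheme \<Rightarrow> ('g \<Rightarrow> 'k::field) \<Rightarrow> (('g \<times> nat) \<times> ('g \<times> nat) \<Rightarrow>\<^sub>0 'k) ring" where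
  "HH_alg G \<eta> = based_algebra ((carrier G \<times> UNIV) \<times> (carrier G \<times> UNIV))
     (\<lambda>(b, c) (b', c'). tensor (H_basis_mult G \<eta> b b') (H_basis_mult G \<eta> c c'))
     (tensor \<one>\<^bsub>H_alg G \<eta>\<^esub> \<one>\<^bsub>H_alg G \<eta>\<^esub>)"

definition H_grp :: "'g \<Rightarrow> ('g \<times> nat \<Rightarrow>\<^sub>0 'k::field)" where
  "H_grp g = Poly_Mapping.single (g, 0) 1"

definition H_x :: "('g, 'm) monoid_scheme \<Rightarrow> ('g \<times> nat \<Rightarrow>\<^sub>0 'k::field)" where
  "H_x G = Poly_Mapping.single (\<one>\<^bsub>G\<^esub>, 1) 1"

text \<open>The algebra map with $\Delta(g) = g \otimes g$ and $\Delta(x) = x \otimes a + 1 \otimes x$.\<close>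

definition comult ::
  "('g, 'm) monoid_scheme \<Rightarrow> ('g \<Rightarrow> 'k::field) \<Rightarrow> 'g
     \<Rightarrow> ('g \<times> nat \<Rightarrow>\<^sub>0 'k) \<Rightarrow> (('g \<times> nat) \<times> ('g \<times> nat) \<Rightarrow>\<^sub>0 'k)" where
  "comult G \<eta> a = lin (\<lambda>(g, i).
     tensor (H_grp g) (H_grp g) \<otimes>\<^bsub>HH_alg G \<eta>\<^esub>
       (tensor (H_x G) (H_grp a) + tensor (H_grp \<one>\<^bsub>G\<^esub>) (H_x G)) [^]\<^bsub>HH_alg G \<eta>\<^esub> i)"


section \<open>Left modules\<close>

record (overloaded) ('h, 'i, 'k::zero) based_module =
  basis :: "'i set"
  act :: "'h \<Rightarrow> ('i \<Rightarrow>\<^sub>0 'k::zero) \<Rightarrow> ('i \<Rightarrow>\<^sub>0 'k)"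

definition space :: "('h, 'i, 'k::zero) based_module \<Rightarrow> ('i \<Rightarrow>\<^sub>0 'k) set" where
  "space M = {v. Poly_Mapping.keys v \<subseteq> basis M}"

locale left_module = ring A
  for A :: "('b \<Rightarrow>\<^sub>0 'k::field) ring" (structure)
  and M :: "('b \<Rightarrow>\<^sub>0 'k, 'i, 'k) based_module" +
  assumes act_closed: "\<lbrakk>h \<in> carrier A; v \<in> space M\<rbrakk> \<Longrightarrow> act M h v \<in> space M"
    and act_add_left: "\<lbrakk>h \<in> carrier A; h' \<in> carrier A; v \<in> space M\<rbrakk>
      \<Longrightarrow> act M (h \<oplus> h') v = act M h v + act M h' v"
    and act_add_right: "\<lbrakk>h \<in> carrier A; v \<in> space M; w \<in> space M\<rbrakk>
      \<Longrightarrow> act M h (v + w) = act M h v + act M h w"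
    and act_scale_left: "\<lbrakk>h \<in> carrier A; v \<in> space M\<rbrakk>
      \<Longrightarrow> act M (scale c h) v = scale c (act M h v)"
    and act_scale_right: "\<lbrakk>h \<in> carrier A; v \<in> space M\<rbrakk>
      \<Longrightarrow> act M h (scale c v) = scale c (act M h v)"
    and act_mult: "\<lbrakk>h \<in> carrier A; h' \<in> carrier A; v \<in> space M\<rbrakk>
      \<Longrightarrow> act M (h \<otimes> h') v = act M h (act M h' v)"
    and act_one: "v \<in> space M \<Longrightarrow> act M \<one> v = v"

definition module_iso ::
  "('b \<Rightarrow>\<^sub>0 'k::field) ring \<Rightarrow> ('b \<Rightarrow>\<^sub>0 'k, 'i, 'k) based_module
     \<Rightarrow> ('b \<Rightarrow>\<^sub>0 'k, 'j, 'k) based_module \<Rightarrow> bool" where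
  "module_iso A M N \<longleftrightarrow> left_module A M \<and> left_module A N \<and>
     (\<exists>f. bij_betw f (space M) (space N) \<and>
          (\<forall>v\<in>space M. \<forall>w\<in>space M. f (v + w) = f v + f w) \<and>
          (\<forall>c. \<forall>v\<in>space M. f (scale c v) = scale c (f v)) \<and>
          (\<forall>h\<in>carrier A. \<forall>v\<in>space M. f (act M h v) = act N h (f v)))"

text \<open>An element $h$ of $kG(\eta, a, 0)$ acts on $M \otimes N$ by
  $h (m \otimes n) = \sum h_{(1)} m \otimes h_{(2)} n$, where $\Delta(h) = \sum h_{(1)} \otimes h_{(2)}$.\<close>

definition tensor_module ::
  "('g, 'm) monoid_scheme \<Rightarrow> ('g \<Rightarrow> 'k::field) \<Rightarrow> 'g
     \<Rightarrow> ('g \<times> nat \<Rightarrow>\<^sub>0 'k, 'i, 'k) based_module \<Rightarrow> ('g \<times> nat \<Rightarrow>\<^sub>0 'k, 'j, 'k) based_module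
     \<Rightarrow> ('g \<times> nat \<Rightarrow>\<^sub>0 'k, 'i \<times> 'j, 'k) based_module" where
  "tensor_module G \<eta> a M N =
     \<lparr>basis = basis M \<times> basis N,
      act = (\<lambda>h. bilin (\<lambda>(b, c) (i, j).
               tensor (act M (Poly_Mapping.single b 1) (Poly_Mapping.single i 1))
                      (act N (Poly_Mapping.single c 1) (Poly_Mapping.single j 1)))
               (comult G \<eta> a h))\<rparr>"

definition direct_sum ::
  "'r set \<Rightarrow> ('r \<Rightarrow> ('h, 'i, 'k::field) based_module) \<Rightarrow> ('h, 'r \<times> 'i, 'k) based_module" where
  "direct_sum R M =
     \<lparr>basis = Sigma R (\<lambda>r. basis (M r)),
      act = (\<lambda>h. lin (\<lambda>(r, i). lin (\<lambda>j. Poly_Mapping.single (r, j) 1)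
               (act (M r) h (Poly_Mapping.single i 1))))\<rparr>"


section \<open>The modules $V_n(\mu, \beta)$\<close>

text \<open>Here $s = |\chi|$, and $\alpha_j$ (for $j < n$) is determined by
  $(y - \beta)^n = y^n - \sum_{j<n} \alpha_j y^j$.\<close>

definition V_coeff :: "nat \<Rightarrow> 'k::field \<Rightarrow> nat \<Rightarrow> 'k" where
  "V_coeff n \<beta> j = - Polynomial.coeff ([:- \<beta>, 1:] ^ n) j"

definition V_grp :: "('g \<Rightarrow> 'k::field) \<Rightarrow> ('g \<Rightarrow> 'k) \<Rightarrow> 'g \<Rightarrow> (nat \<Rightarrow>\<^sub>0 'k) \<Rightarrow> (nat \<Rightarrow>\<^sub>0 'k)" where
  "V_grp \<chi> \<mu> g = lin (\<lambda>i. Poly_Mapping.single i (\<chi> g ^ i * \<mu> g))"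

definition V_x :: "nat \<Rightarrow> nat \<Rightarrow> 'k::field \<Rightarrow> (nat \<Rightarrow>\<^sub>0 'k) \<Rightarrow> (nat \<Rightarrow>\<^sub>0 'k)" where
  "V_x s n \<beta> = lin (\<lambda>i. if i + 1 < n * s then Poly_Mapping.single (i + 1) 1
     else (\<Sum>j<n. Poly_Mapping.single (j * s) (V_coeff n \<beta> j)))"

definition V ::
  "('g, 'm) monoid_scheme \<Rightarrow> ('g \<Rightarrow> 'k::field) \<Rightarrow> nat \<Rightarrow> ('g \<Rightarrow> 'k) \<Rightarrow> 'k
     \<Rightarrow> ('g \<times> nat \<Rightarrow>\<^sub>0 'k, nat, 'k) based_module" where
  "V G \<chi> n \<mu> \<beta> = (let s = group.ord (character_group G) \<chi> in
     \<lparr>basis = {..<n * s},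
      act = bilin (\<lambda>(g, l) i. V_grp \<chi> \<mu> g ((V_x s n \<beta> ^^ l) (Poly_Mapping.single i 1)))\<rparr>)"

end

theory Submission
  imports Defs "HOL-Library.Product_Plus"
begin

text \<open>Since $q$ is a primitive $s$-th root of unity, the $q$-binomial theorem shows that $x^s$ acts on
  the tensor product as $\mu(a)^s\, x^s \otimes 1 + 1 \otimes x^s$, the sum of two commuting operators
  of the form scalar plus nilpotent, with $\mu(a)^s \alpha$, $\beta$ as scalars and $p$, $t$ as
  nilpotency orders. In characteristic zero the Clebsch--Gordan rule decomposes $k[u, v]/(u^p, v^t)$
  into cyclic modules over $k[u + v]$ with explicit generators $c_j$, and the elements
  $c_j (m_i \otimes m_0)$ with $i < s$ generate the direct summands. The map so defined from the
  direct sum is onto, hence bijective because the dimensions agree.\<close>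

section \<open>Linear maps between spaces of finitely supported functions\<close>

text \<open>The element x does not act on the tensor product as multiplication by a polynomial: its
  first summand carries the factor \<open>\<chi> a ^ j * \<mu> a\<close>, which depends on the
  second index j. The s-th power removes this dependence because \<open>\<chi> a ^ s = 1\<close>,
  and that is why the Jordan structure is read off from x^s. The relations u^p = 0 and v^t = 0 are
  kept as membership in an ideal of an honest polynomial ring, which is mapped linearly onto the
  tensor product. The c_j are polynomials in s-th powers, so all their monomials have the same
  character under G, and the s choices of m_i \<otimes> m_0 produce exactly the characters of the
  summands. From these generators x^s reaches only second indices divisible by s; the others come
  from applying x once at a time. On the formal side every module is traded for a family of
  operators satisfying one commutation rule, so that isomorphisms need checking on generators of H
  only.\<close>

lemma lookup_scale [simp]: "Poly_Mapping.lookup (scale c u) b = c * Poly_Mapping.lookup u b"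
  by (auto simp: scale_def map.rep_eq when_def)

interpretation pm: vector_space "scale :: 'k::field \<Rightarrow> ('b \<Rightarrow>\<^sub>0 'k) \<Rightarrow> ('b \<Rightarrow>\<^sub>0 'k)"
  by unfold_locales (auto intro!: poly_mapping_eqI simp: lookup_add algebra_simps)

lemma scale_single [simp]:
  "scale c (Poly_Mapping.single b d) = Poly_Mapping.single b (c * d)"
  by (auto intro!: poly_mapping_eqI simp: lookup_single when_def)

text \<open>Linearity is demanded on the whole type, not only on the space of a module. All
  operators here are extended from basis vectors by \<open>lin\<close>, so they qualify, and two of
  them can be compared on the basis of whichever subspace matters.\<close>

definition linmap :: "(('b \<Rightarrow>\<^sub>0 'k::field) \<Rightarrow> ('c \<Rightarrow>\<^sub>0 'k)) \<Rightarrow> bool" where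
  "linmap f \<longleftrightarrow> (\<forall>u v. f (u + v) = f u + f v) \<and> (\<forall>c u. f (scale c u) = scale c (f u))"

lemma linmapI:
  "(\<And>u v. f (u + v) = f u + f v) \<Longrightarrow> (\<And>c u. f (scale c u) = scale c (f u)) \<Longrightarrow> linmap f"
  by (simp add: linmap_def)

lemma linmap_add: "linmap f \<Longrightarrow> f (u + v) = f u + f v"
  and linmap_scale: "linmap f \<Longrightarrow> f (scale c u) = scale c (f u)"
  by (simp_all add: linmap_def)

lemma linmap_0: "linmap f \<Longrightarrow> f 0 = 0"
  using linmap_scale[of f 0 0] by simp

lemma linmap_uminus: "linmap f \<Longrightarrow> f (- u) = - f u"
  using linmap_scale[of f "-1" u] by simp

lemma linmap_diff: "linmap f \<Longrightarrow> f (u - v) = f u - f v"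
  using linmap_add[of f u "- v"] by (simp add: linmap_uminus[of f v])

lemma linmap_sum: "linmap f \<Longrightarrow> f (\<Sum>x\<in>A. g x) = (\<Sum>x\<in>A. f (g x))"
  by (induction A rule: infinite_finite_induct) (simp_all add: linmap_0 linmap_add[of f])

lemma linmap_id [intro]: "linmap (\<lambda>v. v)"
  by (simp add: linmap_def)

lemma linmap_compose [intro]: "linmap f \<Longrightarrow> linmap g \<Longrightarrow> linmap (\<lambda>v. f (g v))"
  by (simp add: linmap_def)

lemma linmap_plus [intro]: "linmap f \<Longrightarrow> linmap g \<Longrightarrow> linmap (\<lambda>v. f v + g v)"
  by (simp add: linmap_def pm.scale_right_distrib)

lemma linmap_scaled [intro]: "linmap f \<Longrightarrow> linmap (\<lambda>v. scale c (f v))"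
  by (simp add: linmap_def pm.scale_right_distrib mult.commute)

lemma linmap_funpow [intro]:
  fixes f :: "('b \<Rightarrow>\<^sub>0 'k::field) \<Rightarrow> ('b \<Rightarrow>\<^sub>0 'k)"
  shows "linmap f \<Longrightarrow> linmap (f ^^ n)"
  by (induction n) (auto simp: linmap_def)

lemma lin_superset:
  assumes "finite A" "Poly_Mapping.keys u \<subseteq> A"
  shows "lin f u = (\<Sum>b\<in>A. scale (Poly_Mapping.lookup u b) (f b))"
  unfolding lin_def
  by (rule sum.mono_neutral_left) (use assms in \<open>auto simp: in_keys_iff\<close>)

lemma linmap_lin [intro, simp]: "linmap (lin f)"
proof (rule linmapI)
  fix u v :: "'a \<Rightarrow>\<^sub>0 'b"
  let ?A = "Poly_Mapping.keys u \<union> Poly_Mapping.keys v"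
  have "lin f w = (\<Sum>b\<in>?A. scale (Poly_Mapping.lookup w b) (f b))" if "w \<in> {u, v, u + v}" for w
    by (rule lin_superset) (use that keys_add[of u v] in auto)
  then show "lin f (u + v) = lin f u + lin f v"
    by (simp add: lookup_add pm.scale_left_distrib sum.distrib)
next
  fix c and u :: "'a \<Rightarrow>\<^sub>0 'b"
  have "Poly_Mapping.keys (scale c u) \<subseteq> Poly_Mapping.keys u"
    by (auto simp: in_keys_iff)
  then show "lin f (scale c u) = scale c (lin f u)"
    by (simp add: lin_superset[of "Poly_Mapping.keys u"] pm.scale_sum_right)
qed

lemmas lin_add = linmap_add[OF linmap_lin]
  and lin_scale = linmap_scale[OF linmap_lin]
  and lin_zero [simp] = linmap_0[OF linmap_lin]

lemma lin_single [simp]: "lin f (Poly_Mapping.single b c) = scale c (f b)"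
  by (cases "c = 0") (auto simp: lin_def)

lemma lin_ident: "lin (\<lambda>b. Poly_Mapping.single b 1) u = u"
  by (rule poly_mapping_eqI)
     (auto simp: lin_def lookup_sum lookup_single when_def if_distrib in_keys_iff cong: if_cong)

lemma lin_cong: "(\<And>b. b \<in> Poly_Mapping.keys u \<Longrightarrow> f b = g b) \<Longrightarrow> lin f u = lin g u"
  by (simp add: lin_def)

lemma linmap_lin_comp:
  assumes "linmap f"
  shows "f (lin g u) = lin (\<lambda>b. f (g b)) u"
  by (simp add: lin_def linmap_sum[OF assms] linmap_scale[OF assms])

lemma linmap_eq_lin: "linmap f \<Longrightarrow> f u = lin (\<lambda>b. f (Poly_Mapping.single b 1)) u"
  using linmap_lin_comp[of f "\<lambda>b. Poly_Mapping.single b 1" u] by (simp add: lin_ident)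

lemma linmap_eqI:
  assumes "linmap f" "linmap g"
    and "\<And>b. b \<in> Poly_Mapping.keys u \<Longrightarrow> f (Poly_Mapping.single b 1) = g (Poly_Mapping.single b 1)"
  shows "f u = g u"
  unfolding linmap_eq_lin[OF assms(1), of u] linmap_eq_lin[OF assms(2), of u]
  by (rule lin_cong) (rule assms(3))

lemma lin_plus: "lin (\<lambda>b. f b + g b) u = lin f u + lin g u"
  by (simp add: lin_def pm.scale_right_distrib sum.distrib)

lemma lin_scaled: "lin (\<lambda>b. scale c (f b)) u = scale c (lin f u)"
  by (simp add: lin_def pm.scale_sum_right mult.commute)

lemma linmap_lin_param:
  assumes "\<And>b. linmap (f b)"
  shows "linmap (\<lambda>v. lin (\<lambda>b. f b v) u)"
  by (rule linmapI) (simp_all add: linmap_add[OF assms] linmap_scale[OF assms] lin_plus lin_scaled)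

lemma linmap_bilin_left [intro, simp]: "linmap (\<lambda>u. bilin f u v)"
  by (simp add: bilin_def)

lemma linmap_bilin_right [intro, simp]: "linmap (bilin f u)"
  by (rule linmapI) (simp_all add: bilin_def lin_add lin_scale lin_plus lin_scaled)

lemma bilin_single [simp]:
  "bilin f (Poly_Mapping.single a c) (Poly_Mapping.single b d) = scale (c * d) (f a b)"
  by (simp add: bilin_def)

lemma linmap_tensor_left [intro, simp]: "linmap (\<lambda>u. tensor u v)"
  and linmap_tensor_right [intro, simp]: "linmap (tensor u)"
  by (simp_all add: tensor_def)

lemma tensor_single [simp]:
  "tensor (Poly_Mapping.single a c) (Poly_Mapping.single b d) = Poly_Mapping.single (a, b) (c * d)"
  by (simp add: tensor_def)

lemmas tensor_scale_left = linmap_scale[OF linmap_tensor_left]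
  and tensor_scale_right = linmap_scale[OF linmap_tensor_right]

section \<open>Subspaces spanned by basis vectors, and dimension\<close>

definition supp_space :: "'b set \<Rightarrow> ('b \<Rightarrow>\<^sub>0 'k::field) set" where
  "supp_space B = {v. Poly_Mapping.keys v \<subseteq> B}"

lemma single_in_supp_space [simp]: "b \<in> B \<Longrightarrow> Poly_Mapping.single b c \<in> supp_space B"
  by (simp add: supp_space_def)

lemma subspace_supp_space [simp]: "pm.subspace (supp_space B :: ('b \<Rightarrow>\<^sub>0 'k::field) set)"
proof (rule pm.subspaceI)
  fix u v :: "'b \<Rightarrow>\<^sub>0 'k" and c
  show "u + v \<in> supp_space B" if "u \<in> supp_space B" "v \<in> supp_space B"
    using that Poly_Mapping.keys_add[of u v] unfolding supp_space_def by blast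
  show "scale c u \<in> supp_space B" if "u \<in> supp_space B"
    using that by (auto simp: supp_space_def in_keys_iff subset_iff)
qed (simp add: supp_space_def)

lemma supp_space_closed [simp]:
  "u \<in> supp_space B \<Longrightarrow> v \<in> supp_space B \<Longrightarrow> u + v \<in> supp_space B"
  "u \<in> supp_space B \<Longrightarrow> scale c u \<in> supp_space B"
  "0 \<in> supp_space B"
  "u \<in> supp_space B \<Longrightarrow> - u \<in> supp_space B"
  using subspace_supp_space[of B] by (auto simp: pm.subspace_def intro: pm.subspace_neg[OF subspace_supp_space])

lemma lin_in_subspace:
  assumes "pm.subspace S" "u \<in> supp_space B" "\<And>b. b \<in> B \<Longrightarrow> f b \<in> S"
  shows "lin f u \<in> S"
  unfolding lin_def
  by (intro pm.subspace_sum pm.subspace_scale) (use assms in \<open>auto simp: supp_space_def\<close>)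

lemma linmap_in_subspace:
  assumes "linmap f" "pm.subspace S" "u \<in> supp_space B"
    and "\<And>b. b \<in> B \<Longrightarrow> f (Poly_Mapping.single b 1) \<in> S"
  shows "f u \<in> S"
  by (subst linmap_eq_lin[OF assms(1)], rule lin_in_subspace) (use assms in auto)

lemma linmap_eq_on:
  assumes "linmap f" "linmap g" "u \<in> supp_space B"
    and "\<And>b. b \<in> B \<Longrightarrow> f (Poly_Mapping.single b 1) = g (Poly_Mapping.single b 1)"
  shows "f u = g u"
  by (rule linmap_eqI[OF assms(1,2)]) (use assms(3,4) in \<open>auto simp: supp_space_def\<close>)

lemma bilinear_eq_on:
  fixes x :: "'a \<Rightarrow>\<^sub>0 'k::field" and y :: "'b \<Rightarrow>\<^sub>0 'k"
  assumes f: "\<And>x. linmap (\<lambda>y. f x y)" "\<And>y. linmap (\<lambda>x. f x y)"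
    and g: "\<And>x. linmap (\<lambda>y. g x y)" "\<And>y. linmap (\<lambda>x. g x y)"
    and "x \<in> supp_space A" "y \<in> supp_space B"
    and eq: "\<And>a b. a \<in> A \<Longrightarrow> b \<in> B \<Longrightarrow>
      f (Poly_Mapping.single a 1) (Poly_Mapping.single b 1) = g (Poly_Mapping.single a 1) (Poly_Mapping.single b 1)"
  shows "f x y = g x y"
proof (rule linmap_eq_on[OF f(2) g(2) assms(5)])
  fix a assume "a \<in> A"
  then show "f (Poly_Mapping.single a 1) y = g (Poly_Mapping.single a 1) y"
    using eq by (intro linmap_eq_on[OF f(1) g(1) assms(6)])
qed

lemma lin_cong_on:
  "u \<in> supp_space B \<Longrightarrow> (\<And>b. b \<in> B \<Longrightarrow> f b = g b) \<Longrightarrow> lin f u = lin g u"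
  by (rule lin_cong) (auto simp: supp_space_def)

lemma bilin_in_subspace:
  assumes "pm.subspace S" "u \<in> supp_space A" "v \<in> supp_space B"
    and "\<And>a b. a \<in> A \<Longrightarrow> b \<in> B \<Longrightarrow> f a b \<in> S"
  shows "bilin f u v \<in> S"
  unfolding bilin_def by (intro lin_in_subspace[OF assms(1)]) (use assms in auto)

lemma tensor_in_supp_space [simp]:
  "u \<in> supp_space A \<Longrightarrow> v \<in> supp_space B \<Longrightarrow> tensor u v \<in> supp_space (A \<times> B)"
  unfolding tensor_def by (rule bilin_in_subspace) auto

lemma supp_space_eq_span: "supp_space B = pm.span ((\<lambda>b. Poly_Mapping.single b 1) ` B)"
proof
  show "supp_space B \<subseteq> pm.span ((\<lambda>b. Poly_Mapping.single b (1::'b)) ` B)"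
  proof
    fix u :: "'a \<Rightarrow>\<^sub>0 'b" assume "u \<in> supp_space B"
    then have "lin (\<lambda>b. Poly_Mapping.single b 1) u \<in> pm.span ((\<lambda>b. Poly_Mapping.single b 1) ` B)"
      by (intro lin_in_subspace) (auto intro: pm.span_base)
    then show "u \<in> pm.span ((\<lambda>b. Poly_Mapping.single b 1) ` B)" by (simp add: lin_ident)
  qed
  show "pm.span ((\<lambda>b. Poly_Mapping.single b (1::'b)) ` B) \<subseteq> supp_space B"
    by (rule pm.span_minimal) auto
qed

lemma subspace_linmap_image:
  assumes "linmap f" "pm.subspace S"
  shows "pm.subspace (f ` S)"
proof (rule pm.subspaceI)
  show "0 \<in> f ` S"
    by (rule image_eqI[of _ _ 0]) (simp_all add: linmap_0[OF assms(1)] pm.subspace_0[OF assms(2)])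
  show "u + v \<in> f ` S" if "u \<in> f ` S" "v \<in> f ` S" for u v
    using that pm.subspace_add[OF assms(2)]
    by (auto simp: linmap_add[OF assms(1), symmetric])
  show "scale c u \<in> f ` S" if "u \<in> f ` S" for c u
    using that pm.subspace_scale[OF assms(2)]
    by (auto simp: linmap_scale[OF assms(1), symmetric])
qed

lemma subspace_linmap_vimage:
  assumes "linmap f" "pm.subspace S"
  shows "pm.subspace (f -` S)"
  using assms(2)
  by (auto simp: pm.subspace_def linmap_0[OF assms(1)] linmap_add[OF assms(1)] linmap_scale[OF assms(1)])

text \<open>A linear section of a surjection between spaces of the same dimension maps a basis to an
  independent set of full size, hence is onto.\<close>

lemma surj_imp_bij_supp_space:
  fixes f :: "('b \<Rightarrow>\<^sub>0 'k::field) \<Rightarrow> ('c \<Rightarrow>\<^sub>0 'k)"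
  assumes f: "linmap f" and im: "f ` supp_space B = supp_space C"
    and B: "finite B" and card: "card B = card C"
  shows "bij_betw f (supp_space B) (supp_space C)"
proof -
  let ?e = "\<lambda>c :: 'c. Poly_Mapping.single c (1::'k)" and ?d = "\<lambda>b :: 'b. Poly_Mapping.single b (1::'k)"
  have "\<exists>v\<in>supp_space B. f v = ?e c" if "c \<in> C" for c
    using im that by (metis (no_types, lifting) imageE single_in_supp_space)
  then obtain r where r: "\<And>c. c \<in> C \<Longrightarrow> r c \<in> supp_space B" "\<And>c. c \<in> C \<Longrightarrow> f (r c) = ?e c"
    by metis
  have fr: "f (lin r w) = w" if "w \<in> supp_space C" for w
    by (rule linmap_eq_on[where f = "\<lambda>w. f (lin r w)" and g = "\<lambda>w. w", OF _ _ that])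
       (use f r in auto)
  have rB: "lin r w \<in> supp_space B" if "w \<in> supp_space C" for w
    by (rule lin_in_subspace[OF _ that]) (use r in auto)
  have inj: "inj_on r C"
  proof (rule inj_onI)
    fix c c' assume "c \<in> C" "c' \<in> C" "r c = r c'"
    then have "?e c = ?e c'" using r by metis
    then show "c = c'" by (metis lookup_single_eq lookup_single_not_eq zero_neq_one)
  qed
  \<comment> \<open>Applying \<open>f\<close> turns a vanishing combination of the vectors
    \<open>r c\<close> into the same combination of basis vectors, whose coefficients can be read
    off.\<close>
  have indep: "pm.independent (r ` C)"
    unfolding pm.independent_explicit_module
  proof (intro allI impI)
    fix T w v assume T: "finite T" "T \<subseteq> r ` C" "(\<Sum>v\<in>T. scale (w v) v) = 0" "v \<in> T"
    then obtain D where D: "T = r ` D" "D \<subseteq> C" by (meson subset_imageE)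
    then have injD: "inj_on r D" using inj inj_on_subset by blast
    have finD: "finite D" using T(1) D(1) injD by (simp add: finite_image_iff)
    obtain c where c: "c \<in> D" "v = r c" using T(4) D(1) by blast
    have "0 = f (\<Sum>v\<in>T. scale (w v) v)" using T(3) by (simp add: linmap_0[OF f])
    also have "\<dots> = (\<Sum>d\<in>D. scale (w (r d)) (f (r d)))"
      unfolding D(1) by (simp add: sum.reindex[OF injD] linmap_sum[OF f] linmap_scale[OF f])
    also have "\<dots> = (\<Sum>d\<in>D. scale (w (r d)) (?e d))"
      using r D(2) by (intro sum.cong) auto
    finally have "(0::'k) = Poly_Mapping.lookup (\<Sum>d\<in>D. scale (w (r d)) (?e d)) c" by simp
    also have "\<dots> = w (r c)"
      using c(1) finD by (simp add: lookup_sum lookup_single when_def if_distrib cong: if_cong)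
    finally show "w v = 0" using c(2) by simp
  qed
  \<comment> \<open>Steinitz exchange: a basis vector outside the span of the section would give
    \<open>card C + 1\<close> independent vectors inside a space spanned by \<open>card B\<close>
    vectors.\<close>
  have "?d b \<in> pm.span (r ` C)" if "b \<in> B" for b
  proof (rule ccontr)
    assume b: "?d b \<notin> pm.span (r ` C)"
    then have "pm.independent (insert (?d b) (r ` C))"
      using indep by (simp add: pm.independent_insert del: pm.dependent_def)
    moreover have "insert (?d b) (r ` C) \<subseteq> pm.span (?d ` B)"
      using r(1) that unfolding supp_space_eq_span[symmetric] by auto
    ultimately have *: "finite (insert (?d b) (r ` C)) \<and> card (insert (?d b) (r ` C)) \<le> card (?d ` B)"
      using B by (intro pm.independent_span_bound) auto
    have "?d b \<notin> r ` C" using b pm.span_base by blast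
    then have "card C + 1 \<le> card (?d ` B)" 
      using * card_insert_disjoint[of "r ` C" "?d b"] card_image[OF inj] by auto
    also have "\<dots> \<le> card B" using B by (rule card_image_le)
    finally show False using card by simp
  qed
  moreover have "pm.span (r ` C) \<subseteq> lin r ` supp_space C"
    by (rule pm.span_minimal)
       (auto intro!: subspace_linmap_image rev_image_eqI[where x = "?e _"])
  ultimately have "supp_space B \<subseteq> lin r ` supp_space C"
    by (subst supp_space_eq_span, intro pm.span_minimal subspace_linmap_image) auto
  \<comment> \<open>Every vector of the source is now \<open>lin r w\<close>, and \<open>f\<close>
    recovers \<open>w\<close> from it; this is injectivity.\<close>
  then have "\<exists>w\<in>supp_space C. v = lin r w" if "v \<in> supp_space B" for v
    using that by blast
  then have "inj_on f (supp_space B)"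
    by (intro inj_onI) (metis fr)
  then show ?thesis using im by (simp add: bij_betw_def)
qed

section \<open>Representations of $kG(\eta, a, 0)$\<close>

lemma carrier_H_alg: "carrier (H_alg G \<eta>) = supp_space (carrier G \<times> UNIV)"
  by (simp add: H_alg_def based_algebra_def supp_space_def)

lemma H_alg_simps:
  "x \<otimes>\<^bsub>H_alg G \<eta>\<^esub> y = bilin (H_basis_mult G \<eta>) x y"
  "\<one>\<^bsub>H_alg G \<eta>\<^esub> = Poly_Mapping.single (\<one>\<^bsub>G\<^esub>, 0) 1"
  "\<zero>\<^bsub>H_alg G \<eta>\<^esub> = 0"
  "x \<oplus>\<^bsub>H_alg G \<eta>\<^esub> y = x + y"
  by (simp_all add: H_alg_def based_algebra_def)

lemma space_eq: "space M = supp_space (basis M)"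
  by (simp add: space_def supp_space_def)

lemma subspace_space [simp]: "pm.subspace (space M)"
  by (simp add: space_eq)

lemma space_closed [simp]:
  "u \<in> space M \<Longrightarrow> v \<in> space M \<Longrightarrow> u + v \<in> space M"
  "u \<in> space M \<Longrightarrow> scale c u \<in> space M"
  by (simp_all add: space_eq)

text \<open>Associativity rests on multiplicativity of \<eta>: both bracketings of (g x^i)(h x^j)(k
  x^l) collect the scalar \<eta>(h)^i \<eta>(k)^(i+j).\<close>

lemma ring_H_alg:
  fixes \<eta> :: "'g \<Rightarrow> 'k::field"
  assumes G: "group G"
    and \<eta>: "\<And>g h. g \<in> carrier G \<Longrightarrow> h \<in> carrier G \<Longrightarrow> \<eta> (g \<otimes>\<^bsub>G\<^esub> h) = \<eta> g * \<eta> h" "\<eta> \<one>\<^bsub>G\<^esub> = 1"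
  shows "ring (H_alg G \<eta>)"
proof (rule ringI)
  interpret G: group G by fact
  let ?m = "H_basis_mult G \<eta>" and ?B = "carrier G \<times> (UNIV :: nat set)"
  have m_closed: "?m b c \<in> supp_space ?B" if "b \<in> ?B" "c \<in> ?B" for b c
    using that by (auto simp: H_basis_mult_def)
  show "abelian_group (H_alg G \<eta>)"
  proof (rule abelian_groupI, unfold carrier_H_alg H_alg_simps)
    fix x :: "'g \<times> nat \<Rightarrow>\<^sub>0 'k" assume "x \<in> supp_space ?B"
    then show "\<exists>y\<in>supp_space ?B. y + x = 0" by (intro bexI[of _ "- x"]) auto
  qed (auto simp: add_ac)
  show "monoid (H_alg G \<eta>)"
  proof (rule monoidI, unfold carrier_H_alg H_alg_simps)
    fix x y z :: "'g \<times> nat \<Rightarrow>\<^sub>0 'k"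
    assume x: "x \<in> supp_space ?B" and y: "y \<in> supp_space ?B" and z: "z \<in> supp_space ?B"
    show "bilin ?m x y \<in> supp_space ?B"
      by (rule bilin_in_subspace[OF _ x y]) (auto intro: m_closed simp: split_paired_all)
    show "bilin ?m (bilin ?m x y) z = bilin ?m x (bilin ?m y z)"
    proof (rule bilinear_eq_on[OF _ _ _ _ x y])
      fix b c assume bc: "b \<in> ?B" "c \<in> ?B"
      show "bilin ?m (bilin ?m (Poly_Mapping.single b 1) (Poly_Mapping.single c 1)) z =
        bilin ?m (Poly_Mapping.single b 1) (bilin ?m (Poly_Mapping.single c 1) z)"
      proof (rule linmap_eq_on[OF _ _ z])
        fix d assume "d \<in> ?B"
        with bc show "bilin ?m (bilin ?m (Poly_Mapping.single b 1) (Poly_Mapping.single c 1)) (Poly_Mapping.single d 1) =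
          bilin ?m (Poly_Mapping.single b 1) (bilin ?m (Poly_Mapping.single c 1) (Poly_Mapping.single d 1))"
          by (auto simp: H_basis_mult_def \<eta> G.m_assoc power_add power_mult_distrib add_ac mult_ac)
      qed (auto intro: linmap_compose[OF linmap_bilin_right linmap_bilin_right])
    qed (auto intro: linmap_compose[OF linmap_bilin_left linmap_bilin_right]
          linmap_compose[OF linmap_bilin_right linmap_bilin_left]
          linmap_compose[OF linmap_bilin_left linmap_bilin_left])
    show "bilin ?m (Poly_Mapping.single (\<one>\<^bsub>G\<^esub>, 0) 1) x = x"
      by (rule linmap_eq_on[OF _ _ x]) (auto simp: H_basis_mult_def)
    show "bilin ?m x (Poly_Mapping.single (\<one>\<^bsub>G\<^esub>, 0) 1) = x"
      by (rule linmap_eq_on[OF linmap_bilin_left _ x, where g = "\<lambda>x. x"]) (auto simp: H_basis_mult_def \<eta>)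
  qed auto
qed (simp_all add: H_alg_simps linmap_add[OF linmap_bilin_left] linmap_add[OF linmap_bilin_right])

text \<open>A module over $kG(\eta, a, 0)$ amounts to operators \<open>\<gamma> g\<close> (\<open>g \<in> G\<close>) and \<open>\<psi>\<close>
  (the action of $x$) with $x g = \eta(g) g x$.\<close>

locale H_rep =
  fixes G :: "('g, 'm) monoid_scheme" and \<eta> :: "'g \<Rightarrow> 'k::field"
    and M :: "('g \<times> nat \<Rightarrow>\<^sub>0 'k, 'i, 'k) based_module"
    and \<gamma> :: "'g \<Rightarrow> ('i \<Rightarrow>\<^sub>0 'k) \<Rightarrow> ('i \<Rightarrow>\<^sub>0 'k)"
    and \<psi> :: "('i \<Rightarrow>\<^sub>0 'k) \<Rightarrow> ('i \<Rightarrow>\<^sub>0 'k)"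
  assumes linmap_\<gamma>: "\<And>g. linmap (\<gamma> g)" and linmap_\<psi>: "linmap \<psi>"
    and \<gamma>_closed: "\<And>g v. g \<in> carrier G \<Longrightarrow> v \<in> space M \<Longrightarrow> \<gamma> g v \<in> space M"
    and \<psi>_closed: "\<And>v. v \<in> space M \<Longrightarrow> \<psi> v \<in> space M"
    and \<gamma>_one: "\<And>v. v \<in> space M \<Longrightarrow> \<gamma> \<one>\<^bsub>G\<^esub> v = v"
    and \<gamma>_mult: "\<And>g h v. g \<in> carrier G \<Longrightarrow> h \<in> carrier G \<Longrightarrow> v \<in> space M \<Longrightarrow>
      \<gamma> (g \<otimes>\<^bsub>G\<^esub> h) v = \<gamma> g (\<gamma> h v)"
    and \<psi>_\<gamma>: "\<And>g v. g \<in> carrier G \<Longrightarrow> v \<in> space M \<Longrightarrow> \<psi> (\<gamma> g v) = scale (\<eta> g) (\<gamma> g (\<psi> v))"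
    and act_eq: "\<And>h v. h \<in> carrier (H_alg G \<eta>) \<Longrightarrow> v \<in> space M \<Longrightarrow>
      act M h v = lin (\<lambda>(g, l). \<gamma> g ((\<psi> ^^ l) v)) h"
begin

lemma \<psi>_funpow_closed: "v \<in> space M \<Longrightarrow> (\<psi> ^^ l) v \<in> space M"
  by (induction l) (auto simp: \<psi>_closed)

text \<open>The scalar is the structure constant of \<open>H_basis_mult\<close>, so this is what
  makes the action multiplicative. Later it is also read backwards, to find the character of a
  vector obtained by applying x repeatedly.\<close>

lemma \<psi>_funpow_\<gamma>:
  assumes "g \<in> carrier G" "v \<in> space M"
  shows "(\<psi> ^^ l) (\<gamma> g v) = scale (\<eta> g ^ l) (\<gamma> g ((\<psi> ^^ l) v))"
  by (induction l)
     (simp_all add: assms linmap_scale[OF linmap_\<psi>] \<psi>_\<gamma> \<psi>_funpow_closed mult.commute)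

lemma linmap_op: "linmap (\<lambda>v. \<gamma> g ((\<psi> ^^ l) v))"
  using linmap_compose[OF linmap_\<gamma> linmap_funpow[OF linmap_\<psi>]] .

lemma act_single:
  "g \<in> carrier G \<Longrightarrow> v \<in> space M \<Longrightarrow> act M (Poly_Mapping.single (g, l) c) v = scale c (\<gamma> g ((\<psi> ^^ l) v))"
  by (simp add: act_eq carrier_H_alg)

lemma act_closed:
  assumes "h \<in> carrier (H_alg G \<eta>)" "v \<in> space M"
  shows "act M h v \<in> space M"
  unfolding act_eq[OF assms]
  by (rule lin_in_subspace[OF _ assms(1)[unfolded carrier_H_alg]])
     (auto simp: \<gamma>_closed \<psi>_funpow_closed assms)

lemma act_basis_mult:
  assumes b: "b \<in> carrier G \<times> UNIV" and c: "c \<in> carrier G \<times> UNIV" and v: "v \<in> space M" and "group G"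
  shows "act M (H_basis_mult G \<eta> b c) v
    = act M (Poly_Mapping.single b 1) (act M (Poly_Mapping.single c 1) v)"
proof -
  interpret G: group G by fact
  obtain g l h m where "b = (g, l)" "c = (h, m)" "g \<in> carrier G" "h \<in> carrier G" using b c by auto
  then show ?thesis
    using v by (simp add: H_basis_mult_def act_single \<gamma>_mult \<psi>_funpow_closed \<gamma>_closed \<psi>_funpow_\<gamma>
        linmap_scale[OF linmap_\<gamma>] funpow_add)
qed

lemma left_module:
  assumes G: "group G" and ring: "ring (H_alg G \<eta>)"
  shows "left_module (H_alg G \<eta>) M"
proof -
  interpret G: group G by fact
  interpret ring "H_alg G \<eta>" by fact
  have clos: "x + y \<in> carrier (H_alg G \<eta>)" "scale c x \<in> carrier (H_alg G \<eta>)"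
    if "x \<in> carrier (H_alg G \<eta>)" "y \<in> carrier (H_alg G \<eta>)" for x y c
    using that by (simp_all add: carrier_H_alg)
  have linact: "linmap (\<lambda>v. lin (\<lambda>(g, l). \<gamma> g ((\<psi> ^^ l) v)) h)" for h
    by (rule linmap_lin_param) (auto simp: split_beta intro: linmap_op)
  show ?thesis
  proof (unfold_locales, goal_cases)
    case (6 h h' v)
    let ?A = "\<lambda>h v. lin (\<lambda>(g, l). \<gamma> g ((\<psi> ^^ l) v)) h"
    have "?A (bilin (H_basis_mult G \<eta>) h h') v = ?A h (?A h' v)"
    proof (rule bilinear_eq_on[OF _ _ _ _ 6(1,2)[unfolded carrier_H_alg]])
      fix b c :: "'g \<times> nat" assume b: "b \<in> carrier G \<times> UNIV" and c: "c \<in> carrier G \<times> UNIV"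
      then obtain g l k m where "b = (g, l)" "c = (k, m)" "g \<in> carrier G" "k \<in> carrier G" by auto
      then show "?A (bilin (H_basis_mult G \<eta>) (Poly_Mapping.single b 1) (Poly_Mapping.single c 1)) v
        = ?A (Poly_Mapping.single b 1) (?A (Poly_Mapping.single c 1) v)"
        using 6(3) by (simp add: H_basis_mult_def \<gamma>_mult \<psi>_funpow_closed \<gamma>_closed \<psi>_funpow_\<gamma>
          linmap_scale[OF linmap_\<gamma>] funpow_add)
    next
      show "linmap (\<lambda>y. ?A (bilin (H_basis_mult G \<eta>) x y) v)" for x
        by (rule linmap_compose[OF linmap_lin linmap_bilin_right])
      show "linmap (\<lambda>x. ?A (bilin (H_basis_mult G \<eta>) x y) v)" for y
        by (rule linmap_compose[OF linmap_lin linmap_bilin_left])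
      show "linmap (\<lambda>y. ?A x (?A y v))" for x
        by (rule linmap_compose[OF linact linmap_lin])
    qed simp
    then show ?case
      using act_eq[OF m_closed[OF 6(1,2)] 6(3)] act_eq[OF 6(2,3)] act_eq[OF 6(1) act_closed[OF 6(2,3)]]
      by (simp add: H_alg_simps(1))
  next
    case (1 h v)
    then show ?case by (rule act_closed)
  next
    case (7 v)
    then show ?case by (simp add: H_alg_simps act_single \<gamma>_one)
  qed (simp_all add: act_eq clos H_alg_simps lin_add lin_scale
      linmap_add[OF linact] linmap_scale[OF linact])
qed

end

text \<open>A bijection that commutes with the group elements and with x commutes with every g x^l,
  hence with H. It is taken from \<open>N\<close> to \<open>M\<close> because the natural map here
  goes out of the direct sum, which is the second argument of \<open>module_iso\<close>; the
  isomorphism is its inverse.\<close>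

lemma module_iso_of_H_reps:
  assumes G: "group G" and ring: "ring (H_alg G \<eta>)"
    and M: "H_rep G \<eta> M \<gamma> \<psi>" and N: "H_rep G \<eta> N \<gamma>' \<psi>'"
    and f: "linmap f" "bij_betw f (space N) (space M)"
    and \<gamma>: "\<And>g v. g \<in> carrier G \<Longrightarrow> v \<in> space N \<Longrightarrow> f (\<gamma>' g v) = \<gamma> g (f v)"
    and \<psi>: "\<And>v. v \<in> space N \<Longrightarrow> f (\<psi>' v) = \<psi> (f v)"
  shows "module_iso (H_alg G \<eta>) M N"
proof -
  interpret M: H_rep G \<eta> M \<gamma> \<psi> by fact
  interpret N: H_rep G \<eta> N \<gamma>' \<psi>' by fact
  let ?f' = "inv_into (space N) f"
  have MN: "f v \<in> space M" if "v \<in> space N" for v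
    using f(2) that by (auto simp: bij_betw_def)
  have f'_closed: "?f' w \<in> space N" if "w \<in> space M" for w
    using f(2) that by (metis bij_betw_def inv_into_into)
  have ff': "f (?f' w) = w" if "w \<in> space M" for w
    using f(2) that by (metis bij_betw_inv_into_right)
  have f'I: "?f' w = v" if "v \<in> space N" "f v = w" for v w
    using f(2) that by (metis bij_betw_inv_into_left)
  have \<psi>_pow: "f ((\<psi>' ^^ l) v) = (\<psi> ^^ l) (f v)" if "v \<in> space N" for v l
    by (induction l) (simp_all add: \<psi> N.\<psi>_funpow_closed that)
  have act: "f (act N h v) = act M h (f v)" if h: "h \<in> carrier (H_alg G \<eta>)" and v: "v \<in> space N" for h v
  proof -
    have "f (act N h v) = lin (\<lambda>(g, l). f (\<gamma>' g ((\<psi>' ^^ l) v))) h"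
      unfolding N.act_eq[OF h v] linmap_lin_comp[OF f(1)] by (simp add: case_prod_unfold)
    also have "\<dots> = lin (\<lambda>(g, l). \<gamma> g ((\<psi> ^^ l) (f v))) h"
      by (rule lin_cong_on[OF h[unfolded carrier_H_alg]])
         (auto simp: \<gamma> \<psi>_pow N.\<psi>_funpow_closed v)
    finally show ?thesis using h v by (simp add: M.act_eq MN)
  qed
  show ?thesis
    unfolding module_iso_def
  proof (intro conjI exI[of _ ?f'] ballI allI)
    show "left_module (H_alg G \<eta>) M" "left_module (H_alg G \<eta>) N"
      by (rule M.left_module N.left_module; fact)+
    show "bij_betw ?f' (space M) (space N)" by (rule bij_betw_inv_into) fact
    show "?f' (v + w) = ?f' v + ?f' w" if "v \<in> space M" "w \<in> space M" for v w
      using that by (intro f'I) (auto simp: linmap_add[OF f(1)] ff' f'_closed)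
    show "?f' (scale c v) = scale c (?f' v)" if "v \<in> space M" for c v
      using that by (intro f'I) (auto simp: linmap_scale[OF f(1)] ff' f'_closed)
    show "?f' (act M h v) = act N h (?f' v)" if "h \<in> carrier (H_alg G \<eta>)" "v \<in> space M" for h v
      using that by (intro f'I) (auto simp: act ff' f'_closed N.act_closed)
  qed
qed

section \<open>The modules $V_n(\mu, \beta)$, tensor products and direct sums\<close>

lemma carrier_character_groupD:
  assumes "\<chi> \<in> carrier (character_group G)" "g \<in> carrier G" "h \<in> carrier G"
  shows "\<chi> (g \<otimes>\<^bsub>G\<^esub> h) = \<chi> g * \<chi> h" "\<chi> g \<noteq> 0"
  using assms by (auto simp: character_group_def unit_group_def hom_def)

lemma character_one:
  assumes "group G" "\<chi> \<in> carrier (character_group G)"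
  shows "\<chi> \<one>\<^bsub>G\<^esub> = 1"
proof -
  interpret group G by fact
  show ?thesis
    using carrier_character_groupD[OF assms(2) one_closed one_closed] by simp
qed

lemma character_groupI:
  assumes "\<And>g h. g \<in> carrier G \<Longrightarrow> h \<in> carrier G \<Longrightarrow> \<chi> (g \<otimes>\<^bsub>G\<^esub> h) = \<chi> g * \<chi> h"
    and "\<And>g. g \<in> carrier G \<Longrightarrow> \<chi> g \<noteq> 0" and "\<chi> \<in> extensional (carrier G)"
  shows "\<chi> \<in> carrier (character_group G)"
  using assms by (auto simp: character_group_def unit_group_def hom_def)

lemma mult_character_group:
  "g \<in> carrier G \<Longrightarrow> (\<chi> \<otimes>\<^bsub>character_group G\<^esub> \<psi>) g = \<chi> g * \<psi> g"
  by (simp add: character_group_def)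

lemma one_character_group: "g \<in> carrier G \<Longrightarrow> \<one>\<^bsub>character_group G\<^esub> g = 1"
  by (simp add: character_group_def)

lemma pow_character_group:
  "g \<in> carrier G \<Longrightarrow> (\<chi> [^]\<^bsub>character_group G\<^esub> (n::nat)) g = \<chi> g ^ n"
  by (induction n) (simp_all add: mult_character_group one_character_group)

lemma group_character_group:
  assumes "group G"
  shows "group (character_group G :: ('g \<Rightarrow> 'k::field) monoid)"
proof -
  interpret G: group G by fact
  let ?C = "character_group G :: ('g \<Rightarrow> 'k) monoid"
  have ext: "\<chi> = \<phi>" if "\<chi> \<in> carrier ?C" "\<phi> \<in> carrier ?C" "\<And>g. g \<in> carrier G \<Longrightarrow> \<chi> g = \<phi> g" for \<chi> \<phi>
    using that by (intro extensionalityI[of _ "carrier G"]) (auto simp: character_group_def)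
  have mult: "\<chi> \<otimes>\<^bsub>?C\<^esub> \<phi> \<in> carrier ?C" if "\<chi> \<in> carrier ?C" "\<phi> \<in> carrier ?C" for \<chi> \<phi>
    using that by (intro character_groupI)
      (auto simp: mult_character_group carrier_character_groupD, simp add: character_group_def)
  have one: "\<one>\<^bsub>?C\<^esub> \<in> carrier ?C"
    by (intro character_groupI) (auto simp: one_character_group, simp add: character_group_def)
  show ?thesis
  proof (rule groupI)
    fix \<chi> assume \<chi>: "\<chi> \<in> carrier ?C"
    let ?i = "\<lambda>g\<in>carrier G. inverse (\<chi> g)"
    have "?i \<in> carrier ?C"
      by (intro character_groupI) (auto simp: carrier_character_groupD[OF \<chi>])
    then show "\<exists>\<phi>\<in>carrier ?C. \<phi> \<otimes>\<^bsub>?C\<^esub> \<chi> = \<one>\<^bsub>?C\<^esub>"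
      by (intro bexI[of _ ?i] ext mult one \<chi>)
         (auto simp: mult_character_group one_character_group carrier_character_groupD[OF \<chi>])
  qed (auto intro!: ext mult one simp: mult_character_group one_character_group mult.assoc)
qed

lemma inv_character_group:
  assumes "group G" "\<chi> \<in> carrier (character_group G)" "g \<in> carrier G"
  shows "(inv\<^bsub>character_group G\<^esub> \<chi>) g = inverse (\<chi> g :: 'k::field)"
proof -
  interpret C: group "character_group G :: ('a \<Rightarrow> 'k) monoid"
    by (rule group_character_group) fact
  have "(inv\<^bsub>character_group G\<^esub> \<chi> \<otimes>\<^bsub>character_group G\<^esub> \<chi>) g = 1"
    using assms(3) by (simp add: C.l_inv[OF assms(2)] one_character_group)
  then have "(inv\<^bsub>character_group G\<^esub> \<chi>) g * \<chi> g = 1"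
    using assms(3) by (simp add: mult_character_group)
  then show ?thesis
    using inverse_unique mult.commute by metis
qed

section \<open>The modules V_n as operator pairs\<close>

lemma linmap_V_grp: "linmap (V_grp \<chi> \<mu> g)" and linmap_V_x: "linmap (V_x s n \<beta>)"
  by (simp_all add: V_grp_def V_x_def)

lemma V_grp_single [simp]:
  "V_grp \<chi> \<mu> g (Poly_Mapping.single i c) = Poly_Mapping.single i (\<chi> g ^ i * \<mu> g * c)"
  by (simp add: V_grp_def mult_ac)

text \<open>The operator x raises the exponent of \<chi> by one along the basis. At the last vector
  it falls back to the vectors m_(js), and the commutation rule survives there because \<chi>^s =
  1.\<close>

lemma H_rep_V:
  fixes \<chi> \<mu> :: "'g \<Rightarrow> 'k::field"
  assumes G: "group G" and \<chi>: "\<chi> \<in> carrier (character_group G)" and \<mu>: "\<mu> \<in> carrier (character_group G)"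
    and \<eta>: "\<And>g. g \<in> carrier G \<Longrightarrow> \<eta> g = inverse (\<chi> g)"
    and s: "group.ord (character_group G) \<chi> = s" "s > 0"
  shows "H_rep G \<eta> (V G \<chi> n \<mu> \<beta>) (V_grp \<chi> \<mu>) (V_x s n \<beta>)"
proof -
  interpret G: group G by fact
  interpret C: group "character_group G :: ('g \<Rightarrow> 'k) monoid"
    by (rule group_character_group) fact
  have \<chi>s: "\<chi> g ^ s = 1" if "g \<in> carrier G" for g
    using C.pow_ord_eq_1[OF \<chi>] that by (simp add: s pow_character_group[symmetric] one_character_group)
  have space: "space (V G \<chi> n \<mu> \<beta>) = supp_space {..<n * s}"
    by (simp add: space_eq V_def s Let_def)
  note \<chi>' = carrier_character_groupD[OF \<chi>] and \<mu>' = carrier_character_groupD[OF \<mu>]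
  have js: "j * s < n * s" if "j < n" for j
    using that s by simp
  show ?thesis
  proof (unfold_locales, unfold space)
    show "linmap (V_grp \<chi> \<mu> g)" "linmap (V_x s n \<beta>)" for g
      by (rule linmap_V_grp linmap_V_x)+
    show "V_grp \<chi> \<mu> g v \<in> supp_space {..<n * s}" if "v \<in> supp_space {..<n * s}" for g v
      by (rule linmap_in_subspace[OF linmap_V_grp _ that]) auto
    show "V_x s n \<beta> v \<in> supp_space {..<n * s}" if "v \<in> supp_space {..<n * s}" for v
      by (rule linmap_in_subspace[OF linmap_V_x _ that])
         (auto simp: V_x_def intro!: pm.subspace_sum single_in_supp_space js)
    show "V_grp \<chi> \<mu> \<one>\<^bsub>G\<^esub> v = v" for v
      by (rule linmap_eqI[OF linmap_V_grp linmap_id])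
         (simp add: character_one[OF G \<chi>] character_one[OF G \<mu>])
    show "V_grp \<chi> \<mu> (g \<otimes>\<^bsub>G\<^esub> h) v = V_grp \<chi> \<mu> g (V_grp \<chi> \<mu> h v)"
      if "g \<in> carrier G" "h \<in> carrier G" for g h v
      by (rule linmap_eqI[OF linmap_V_grp linmap_compose[OF linmap_V_grp linmap_V_grp]])
         (simp add: \<chi>' \<mu>' that power_mult_distrib mult_ac)
    show "V_x s n \<beta> (V_grp \<chi> \<mu> g v) = scale (\<eta> g) (V_grp \<chi> \<mu> g (V_x s n \<beta> v))"
      if g: "g \<in> carrier G" and v: "v \<in> supp_space {..<n * s}" for g v
    proof (rule linmap_eq_on[OF linmap_compose[OF linmap_V_x linmap_V_grp]
          linmap_scaled[OF linmap_compose[OF linmap_V_grp linmap_V_x]] v])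
      fix i assume i: "i \<in> {..<n * s}"
      show "V_x s n \<beta> (V_grp \<chi> \<mu> g (Poly_Mapping.single i 1))
        = scale (\<eta> g) (V_grp \<chi> \<mu> g (V_x s n \<beta> (Poly_Mapping.single i 1)))"
      proof (cases "i + 1 < n * s")
        case True
        then show ?thesis using \<chi>'(2)[OF g g] by (simp add: V_x_def \<eta>[OF g] field_simps)
      next
        case False
        \<comment> \<open>Here \<chi>(g)^i = \<chi>(g)^(ns-1) is the inverse of \<chi>(g), while
          every target m_(js) carries the factor \<chi>(g)^(js) = 1; the two sides differ by exactly
          \<eta>(g).\<close>
        with i have "i + 1 = n * s" by simp
        then have "\<chi> g * \<chi> g ^ i = 1"
          by (metis Suc_eq_plus1 \<chi>s g mult.commute power_Suc power_mult power_one)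
        then have "\<chi> g ^ i = \<eta> g" using \<chi>'(2)[OF g g] by (simp add: \<eta>[OF g] field_simps)
        moreover have "\<chi> g ^ (j * s) = 1" for j
          using \<chi>s[OF g] by (metis mult.commute power_mult power_one)
        ultimately show ?thesis using False
          by (simp add: V_x_def pm.scale_sum_right linmap_sum[OF linmap_V_grp] mult_ac)
      qed
    qed
    show "act (V G \<chi> n \<mu> \<beta>) h v = lin (\<lambda>(g, l). V_grp \<chi> \<mu> g ((V_x s n \<beta> ^^ l) v)) h" for h v
      unfolding V_def s Let_def
    proof (simp add: bilin_def, rule lin_cong, clarsimp)
      fix g l
      show "lin (\<lambda>i. V_grp \<chi> \<mu> g ((V_x s n \<beta> ^^ l) (Poly_Mapping.single i 1))) v
        = V_grp \<chi> \<mu> g ((V_x s n \<beta> ^^ l) v)"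
        by (rule linmap_eq_lin[symmetric])
           (rule linmap_compose[OF linmap_V_grp linmap_funpow[OF linmap_V_x]])
    qed
  qed
qed

section \<open>Tensor products of representations\<close>

definition tensor_map ::
  "(('i \<Rightarrow>\<^sub>0 'k::field) \<Rightarrow> ('i \<Rightarrow>\<^sub>0 'k)) \<Rightarrow> (('j \<Rightarrow>\<^sub>0 'k) \<Rightarrow> ('j \<Rightarrow>\<^sub>0 'k)) \<Rightarrow> ('i \<times> 'j \<Rightarrow>\<^sub>0 'k) \<Rightarrow> ('i \<times> 'j \<Rightarrow>\<^sub>0 'k)" where
  "tensor_map f g = lin (\<lambda>(i, j). tensor (f (Poly_Mapping.single i 1)) (g (Poly_Mapping.single j 1)))"

lemma linmap_tensor_map [simp]: "linmap (tensor_map f g)"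
  by (simp add: tensor_map_def)

lemma tensor_map_single:
  "tensor_map f g (Poly_Mapping.single (i, j) 1)
    = tensor (f (Poly_Mapping.single i 1)) (g (Poly_Mapping.single j 1))"
  by (simp add: tensor_map_def)

lemma tensor_map_tensor:
  assumes f: "linmap f" and g: "linmap g"
  shows "tensor_map f g (tensor u v) = tensor (f u) (g v)"
proof (rule bilinear_eq_on[where A = UNIV and B = UNIV
      and f = "\<lambda>u v. tensor_map f g (tensor u v)" and g = "\<lambda>u v. tensor (f u) (g v)"])
  show "linmap (\<lambda>v. tensor_map f g (tensor u v))" for u
    by (rule linmap_compose[OF linmap_tensor_map linmap_tensor_right])
  show "linmap (\<lambda>u. tensor_map f g (tensor u v))" for v
    by (rule linmap_compose[OF linmap_tensor_map linmap_tensor_left])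
  show "linmap (\<lambda>v. tensor (f u) (g v))" for u
    by (rule linmap_compose[OF linmap_tensor_right g])
  show "linmap (\<lambda>u. tensor (f u) (g v))" for v
    by (rule linmap_compose[OF linmap_tensor_left f])
qed (simp_all add: supp_space_def tensor_map_single)

lemma space_tensor_module: "space (tensor_module G \<eta> a M N) = supp_space (basis M \<times> basis N)"
  by (simp add: space_eq tensor_module_def)

lemma linmap_eq_on_tensor:
  assumes "linmap f" "linmap g" "v \<in> supp_space (B \<times> C)"
    and "\<And>i j. i \<in> B \<Longrightarrow> j \<in> C \<Longrightarrow>
      f (tensor (Poly_Mapping.single i 1) (Poly_Mapping.single j 1))
      = g (tensor (Poly_Mapping.single i 1) (Poly_Mapping.single j 1))"
  shows "f v = g v"
  by (rule linmap_eq_on[OF assms(1,2,3)]) (use assms(4) in auto)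

locale H_rep_pair =
  M: H_rep G \<eta> M \<gamma>\<^sub>1 \<psi>\<^sub>1 + N: H_rep G \<eta> N \<gamma>\<^sub>2 \<psi>\<^sub>2 + G: group G
  for G :: "('g, 'm) monoid_scheme" (structure) and \<eta> :: "'g \<Rightarrow> 'k::field"
    and M :: "('g \<times> nat \<Rightarrow>\<^sub>0 'k, 'i, 'k) based_module" and \<gamma>\<^sub>1 \<psi>\<^sub>1
    and N :: "('g \<times> nat \<Rightarrow>\<^sub>0 'k, 'j, 'k) based_module" and \<gamma>\<^sub>2 \<psi>\<^sub>2 +
  fixes a :: 'g
  assumes a: "a \<in> center G"
begin

abbreviation "HB \<equiv> carrier G \<times> (UNIV :: nat set)"
abbreviation "MN \<equiv> tensor_module G \<eta> a M N"

text \<open>The action of H \<otimes> H on M \<otimes> N. The action in \<open>tensor_module\<close>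
  is this one precomposed with \<open>comult\<close>.\<close>

definition pair_act :: "(('g \<times> nat) \<times> ('g \<times> nat) \<Rightarrow>\<^sub>0 'k) \<Rightarrow> ('i \<times> 'j \<Rightarrow>\<^sub>0 'k) \<Rightarrow> ('i \<times> 'j \<Rightarrow>\<^sub>0 'k)" where
  "pair_act = bilin (\<lambda>(b, c) (i, j).
     tensor (act M (Poly_Mapping.single b 1) (Poly_Mapping.single i 1))
            (act N (Poly_Mapping.single c 1) (Poly_Mapping.single j 1)))"

definition \<gamma> :: "'g \<Rightarrow> ('i \<times> 'j \<Rightarrow>\<^sub>0 'k) \<Rightarrow> ('i \<times> 'j \<Rightarrow>\<^sub>0 'k)" where
  "\<gamma> g = tensor_map (\<gamma>\<^sub>1 g) (\<gamma>\<^sub>2 g)"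

definition \<psi> :: "('i \<times> 'j \<Rightarrow>\<^sub>0 'k) \<Rightarrow> ('i \<times> 'j \<Rightarrow>\<^sub>0 'k)" where
  "\<psi> v = tensor_map \<psi>\<^sub>1 (\<gamma>\<^sub>2 a) v + tensor_map (\<lambda>v. v) \<psi>\<^sub>2 v"

lemma linmap_pair_act_left [simp]: "linmap (\<lambda>w. pair_act w v)"
  and linmap_pair_act_right [simp]: "linmap (pair_act w)"
  by (simp_all add: pair_act_def)

lemma linmap_\<gamma> [simp]: "linmap (\<gamma> g)"
  by (simp add: \<gamma>_def)

lemma linmap_\<psi> [simp]: "linmap \<psi>"
  unfolding \<psi>_def [abs_def] by (intro linmap_plus) simp_all

lemma \<gamma>_tensor: "\<gamma> g (tensor u v) = tensor (\<gamma>\<^sub>1 g u) (\<gamma>\<^sub>2 g v)"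
  by (simp add: \<gamma>_def tensor_map_tensor M.linmap_\<gamma> N.linmap_\<gamma>)

lemma \<psi>_tensor: "\<psi> (tensor u v) = tensor (\<psi>\<^sub>1 u) (\<gamma>\<^sub>2 a v) + tensor u (\<psi>\<^sub>2 v)"
  by (simp add: \<psi>_def tensor_map_tensor M.linmap_\<psi> N.linmap_\<psi> N.linmap_\<gamma> linmap_id)

lemma a_carrier: "a \<in> carrier G" and a_commute: "g \<in> carrier G \<Longrightarrow> a \<otimes> g = g \<otimes> a"
  using a by (simp_all add: center_def)

lemma pair_act_tensor:
  assumes u: "u \<in> supp_space HB" and w: "w \<in> supp_space HB" and m: "m \<in> space M" and n: "n \<in> space N"
  shows "pair_act (tensor u w) (tensor m n) = tensor (act M u m) (act N w n)"
proof -
  \<comment> \<open>\<open>act\<close> is given by operators only on the carrier and on the module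
    space. These formulas agree with it there and are linear everywhere, as the extension from basis
    vectors requires.\<close>
  let ?A = "\<lambda>h v. lin (\<lambda>(g, l). \<gamma>\<^sub>1 g ((\<psi>\<^sub>1 ^^ l) v)) h" and ?B = "\<lambda>h v. lin (\<lambda>(g, l). \<gamma>\<^sub>2 g ((\<psi>\<^sub>2 ^^ l) v)) h"
  have linA: "linmap (?A h)" for h
    by (rule linmap_lin_param) (auto simp: split_beta intro: M.linmap_op)
  have linB: "linmap (?B h)" for h
    by (rule linmap_lin_param) (auto simp: split_beta intro: N.linmap_op)
  have "pair_act (tensor u w) (tensor m n) = tensor (?A u m) (?B w n)"
  proof (rule bilinear_eq_on[OF _ _ _ _ u w])
    fix b c assume b: "b \<in> HB" and c: "c \<in> HB"
    let ?b = "Poly_Mapping.single b (1::'k)" and ?c = "Poly_Mapping.single c (1::'k)"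
    show "pair_act (tensor ?b ?c) (tensor m n) = tensor (?A ?b m) (?B ?c n)"
    proof (rule bilinear_eq_on[OF _ _ _ _ m[unfolded space_eq] n[unfolded space_eq]])
      fix i j assume i: "i \<in> basis M" and j: "j \<in> basis N"
      let ?i = "Poly_Mapping.single i (1::'k)" and ?j = "Poly_Mapping.single j (1::'k)"
      have "pair_act (tensor ?b ?c) (tensor ?i ?j) = tensor (act M ?b ?i) (act N ?c ?j)"
        by (simp add: pair_act_def)
      also have "act M ?b ?i = ?A ?b ?i"
        by (rule M.act_eq) (use b i in \<open>auto simp: carrier_H_alg space_eq\<close>)
      also have "act N ?c ?j = ?B ?c ?j"
        by (rule N.act_eq) (use c j in \<open>auto simp: carrier_H_alg space_eq\<close>)
      finally show "pair_act (tensor ?b ?c) (tensor ?i ?j) = tensor (?A ?b ?i) (?B ?c ?j)" .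
    next
      show "linmap (\<lambda>n. pair_act (tensor ?b ?c) (tensor m n))" for m
        by (rule linmap_compose[OF linmap_pair_act_right linmap_tensor_right])
      show "linmap (\<lambda>m. pair_act (tensor ?b ?c) (tensor m n))" for n
        by (rule linmap_compose[OF linmap_pair_act_right linmap_tensor_left])
      show "linmap (\<lambda>n. tensor (?A ?b m) (?B ?c n))" for m
        by (rule linmap_compose[OF linmap_tensor_right linB])
      show "linmap (\<lambda>m. tensor (?A ?b m) (?B ?c n))" for n
        by (rule linmap_compose[OF linmap_tensor_left linA])
    qed
  next
    show "linmap (\<lambda>w. pair_act (tensor u w) (tensor m n))" for u
      by (rule linmap_compose[OF linmap_pair_act_left linmap_tensor_right])
    show "linmap (\<lambda>u. pair_act (tensor u w) (tensor m n))" for w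
      by (rule linmap_compose[OF linmap_pair_act_left linmap_tensor_left])
    show "linmap (\<lambda>w. tensor (?A u m) (?B w n))" for u
      by (rule linmap_compose[OF linmap_tensor_right linmap_lin])
    show "linmap (\<lambda>u. tensor (?A u m) (?B w n))" for w
      by (rule linmap_compose[OF linmap_tensor_left linmap_lin])
  qed
  then show ?thesis using assms by (simp add: M.act_eq N.act_eq carrier_H_alg)
qed

lemma pair_act_closed:
  assumes "w \<in> supp_space (HB \<times> HB)" "v \<in> space MN"
  shows "pair_act w v \<in> space MN"
  unfolding pair_act_def space_tensor_module
  by (rule bilin_in_subspace[OF _ assms[unfolded space_tensor_module[of G \<eta> a M N]]])
     (auto intro!: tensor_in_supp_space M.act_closed[unfolded space_eq] N.act_closed[unfolded space_eq]
       simp: carrier_H_alg)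

lemma H_basis_mult_closed: "b \<in> HB \<Longrightarrow> c \<in> HB \<Longrightarrow> H_basis_mult G \<eta> b c \<in> supp_space HB"
  by (auto simp: H_basis_mult_def)

lemma HH_mult_closed:
  "w \<in> supp_space (HB \<times> HB) \<Longrightarrow> w' \<in> supp_space (HB \<times> HB) \<Longrightarrow> w \<otimes>\<^bsub>HH_alg G \<eta>\<^esub> w' \<in> supp_space (HB \<times> HB)"
  by (auto simp: HH_alg_def based_algebra_def
      intro!: bilin_in_subspace tensor_in_supp_space H_basis_mult_closed)

text \<open>By bilinearity it suffices to multiply basis elements, where each tensor factor reduces
  to the module law of \<open>M\<close> or of \<open>N\<close>. It allows the powers of \<Delta>(x)
  inside \<open>comult\<close> to be evaluated one factor at a time.\<close>

lemma pair_act_mult: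
  assumes w: "w \<in> supp_space (HB \<times> HB)" and w': "w' \<in> supp_space (HB \<times> HB)" and v: "v \<in> space MN"
  shows "pair_act (w \<otimes>\<^bsub>HH_alg G \<eta>\<^esub> w') v = pair_act w (pair_act w' v)"
proof -
  let ?m = "\<lambda>(b, c) (b', c'). tensor (H_basis_mult G \<eta> b b') (H_basis_mult G \<eta> c c')"
  have "pair_act (bilin ?m w w') v = pair_act w (pair_act w' v)"
  proof (rule bilinear_eq_on[OF _ _ _ _ w w'])
    fix x y assume x: "x \<in> HB \<times> HB" and y: "y \<in> HB \<times> HB"
    obtain b c b' c' where xy: "x = (b, c)" "y = (b', c')" and bc: "b \<in> HB" "c \<in> HB" "b' \<in> HB" "c' \<in> HB"
      using x y by blast
    let ?x = "Poly_Mapping.single x (1::'k)" and ?y = "Poly_Mapping.single y (1::'k)"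
    let ?b = "Poly_Mapping.single b (1::'k)" and ?c = "Poly_Mapping.single c (1::'k)"
    let ?b' = "Poly_Mapping.single b' (1::'k)" and ?c' = "Poly_Mapping.single c' (1::'k)"
    show "pair_act (bilin ?m ?x ?y) v = pair_act ?x (pair_act ?y v)"
    proof (rule linmap_eq_on_tensor[OF _ _ v[unfolded space_tensor_module[of G \<eta> a M N]]])
      fix i j assume i: "i \<in> basis M" and j: "j \<in> basis N"
      let ?i = "Poly_Mapping.single i (1::'k)" and ?j = "Poly_Mapping.single j (1::'k)"
      have ij: "?i \<in> space M" "?j \<in> space N" using i j by (auto simp: space_eq)
      have H: "?b \<in> carrier (H_alg G \<eta>)" "?b' \<in> carrier (H_alg G \<eta>)" "?c \<in> carrier (H_alg G \<eta>)"
        "?c' \<in> carrier (H_alg G \<eta>)" using bc by (auto simp: carrier_H_alg)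
      have "pair_act (bilin ?m ?x ?y) (tensor ?i ?j) =
          pair_act (tensor (H_basis_mult G \<eta> b b') (H_basis_mult G \<eta> c c')) (tensor ?i ?j)"
        by (simp add: xy)
      also have "\<dots> = tensor (act M (H_basis_mult G \<eta> b b') ?i) (act N (H_basis_mult G \<eta> c c') ?j)"
        by (intro pair_act_tensor H_basis_mult_closed ij bc)
      also have "\<dots> = tensor (act M ?b (act M ?b' ?i)) (act N ?c (act N ?c' ?j))"
        using bc ij by (simp add: M.act_basis_mult N.act_basis_mult G.is_group)
      also have "\<dots> = pair_act (tensor ?b ?c) (tensor (act M ?b' ?i) (act N ?c' ?j))"
        by (rule pair_act_tensor[symmetric]) (auto intro!: M.act_closed N.act_closed H ij bc single_in_supp_space)
      also have "tensor (act M ?b' ?i) (act N ?c' ?j) = pair_act (tensor ?b' ?c') (tensor ?i ?j)"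
        by (rule pair_act_tensor[symmetric]) (auto intro!: ij bc single_in_supp_space)
      finally show "pair_act (bilin ?m ?x ?y) (tensor ?i ?j) = pair_act ?x (pair_act ?y (tensor ?i ?j))"
        by (simp add: xy)
    next
      show "linmap (\<lambda>v. pair_act ?x (pair_act ?y v))"
        by (rule linmap_compose[OF linmap_pair_act_right linmap_pair_act_right])
    qed simp
  next
    show "linmap (\<lambda>w'. pair_act (bilin ?m w w') v)" for w
      by (rule linmap_compose[OF linmap_pair_act_left linmap_bilin_right])
    show "linmap (\<lambda>w. pair_act (bilin ?m w w') v)" for w'
      by (rule linmap_compose[OF linmap_pair_act_left linmap_bilin_left])
    show "linmap (\<lambda>w'. pair_act w (pair_act w' v))" for w
      by (rule linmap_compose[OF linmap_pair_act_right linmap_pair_act_left])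
  qed simp
  then show ?thesis by (simp add: HH_alg_def based_algebra_def)
qed

lemma pair_act_grp:
  assumes g: "g \<in> carrier G" and v: "v \<in> space MN"
  shows "pair_act (tensor (H_grp g) (H_grp g)) v = \<gamma> g v"
  by (rule linmap_eq_on_tensor[OF _ _ v[unfolded space_tensor_module[of G \<eta> a M N]]])
     (simp_all only: linmap_pair_act_right linmap_\<gamma>,
      simp add: pair_act_tensor H_grp_def g space_eq M.act_single N.act_single \<gamma>_tensor
      del: tensor_single)

abbreviation "\<Delta>x \<equiv> tensor (H_x G) (H_grp a) + tensor (H_grp \<one>) (H_x G)"

lemma pair_act_\<Delta>x:
  assumes v: "v \<in> space MN"
  shows "pair_act \<Delta>x v = \<psi> v"
  by (rule linmap_eq_on_tensor[OF _ _ v[unfolded space_tensor_module[of G \<eta> a M N]]])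
     (simp_all only: linmap_pair_act_right linmap_\<psi>,
      simp add: pair_act_tensor H_grp_def H_x_def a_carrier space_eq M.act_single N.act_single \<psi>_tensor
       linmap_add[OF linmap_pair_act_left] M.\<gamma>_one N.\<gamma>_one M.\<psi>_closed N.\<psi>_closed
       M.\<psi>_closed[unfolded space_eq] N.\<psi>_closed[unfolded space_eq]
      del: tensor_single)

lemma \<Delta>x_pow_closed: "\<Delta>x [^]\<^bsub>HH_alg G \<eta>\<^esub> (l::nat) \<in> supp_space (HB \<times> HB)"
proof (induction l)
  case 0
  show ?case by (simp add: HH_alg_def based_algebra_def H_alg_simps)
next
  case (Suc l)
  then show ?case
    by (simp only: nat_pow_Suc, intro HH_mult_closed)
       (auto simp: H_grp_def H_x_def a_carrier)
qed

lemma pair_act_\<Delta>x_pow: "v \<in> space MN \<Longrightarrow> pair_act (\<Delta>x [^]\<^bsub>HH_alg G \<eta>\<^esub> (l::nat)) v = (\<psi> ^^ l) v"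
proof (induction l arbitrary: v)
  case 0
  have "\<one>\<^bsub>HH_alg G \<eta>\<^esub> = tensor (H_grp \<one>) (H_grp \<one>)"
    by (simp add: HH_alg_def based_algebra_def H_alg_simps H_grp_def)
  moreover have "\<gamma> \<one> v = v"
    by (rule linmap_eq_on_tensor[OF linmap_\<gamma> linmap_id 0[unfolded space_tensor_module[of G \<eta> a M N]]])
       (simp add: \<gamma>_tensor M.\<gamma>_one N.\<gamma>_one space_eq del: tensor_single)
  ultimately show ?case using 0 by (simp add: pair_act_grp)
next
  case (Suc l)
  have X: "\<Delta>x \<in> supp_space (HB \<times> HB)"
    by (auto simp: H_grp_def H_x_def a_carrier)
  have "\<psi> v \<in> space MN"
    using pair_act_closed[OF X Suc.prems] by (simp add: pair_act_\<Delta>x[OF Suc.prems])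
  then show ?case
    by (simp add: pair_act_mult[OF \<Delta>x_pow_closed X Suc.prems] pair_act_\<Delta>x[OF Suc.prems] Suc.IH
        funpow_swap1)
qed

text \<open>By definition \<open>comult\<close> sends g x^l to \<Delta>(g) \<Delta>(x)^l, so
  multiplicativity of \<open>pair_act\<close> already yields the required form of the action. The
  commutation rule is then verified directly on the operators.\<close>

lemma H_rep_tensor: "H_rep G \<eta> MN \<gamma> \<psi>"
proof
  have sp: "Poly_Mapping.single i 1 \<in> space M" if "i \<in> basis M" for i using that by (simp add: space_eq)
  have sp': "Poly_Mapping.single j 1 \<in> space N" if "j \<in> basis N" for j using that by (simp add: space_eq)
  have X: "\<Delta>x \<in> supp_space (HB \<times> HB)"
    by (auto simp: H_grp_def H_x_def a_carrier)
  show "linmap (\<gamma> g)" "linmap \<psi>" for g by simp_all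
  show "\<gamma> g v \<in> space MN" if "g \<in> carrier G" "v \<in> space MN" for g v
    unfolding pair_act_grp[OF that, symmetric]
    by (rule pair_act_closed) (use that in \<open>auto simp: H_grp_def\<close>)
  show "\<psi> v \<in> space MN" if "v \<in> space MN" for v
    unfolding pair_act_\<Delta>x[OF that, symmetric] by (rule pair_act_closed[OF X that])
  show "\<gamma> \<one> v = v" if "v \<in> space MN" for v
    by (rule linmap_eq_on_tensor[OF linmap_\<gamma> linmap_id that[unfolded space_tensor_module]])
       (simp add: \<gamma>_tensor M.\<gamma>_one N.\<gamma>_one sp sp' del: tensor_single)
  show "\<gamma> (g \<otimes> h) v = \<gamma> g (\<gamma> h v)" if "g \<in> carrier G" "h \<in> carrier G" "v \<in> space MN" for g h v
    by (rule linmap_eq_on_tensor[OF linmap_\<gamma> linmap_compose[OF linmap_\<gamma> linmap_\<gamma>] that(3)[unfolded space_tensor_module]])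
       (simp add: \<gamma>_tensor M.\<gamma>_mult N.\<gamma>_mult sp sp' that del: tensor_single)
  show "\<psi> (\<gamma> g v) = scale (\<eta> g) (\<gamma> g (\<psi> v))" if g: "g \<in> carrier G" and v: "v \<in> space MN" for g v
  proof (rule linmap_eq_on_tensor[OF linmap_compose[OF linmap_\<psi> linmap_\<gamma>]
        linmap_scaled[OF linmap_compose[OF linmap_\<gamma> linmap_\<psi>]] v[unfolded space_tensor_module]])
    fix i j assume i: "i \<in> basis M" and j: "j \<in> basis N"
    \<comment> \<open>Centrality of a enters here: the group part of x \<otimes> a must commute with
      the action of g.\<close>
    have "\<gamma>\<^sub>2 a (\<gamma>\<^sub>2 g (Poly_Mapping.single j 1)) = \<gamma>\<^sub>2 g (\<gamma>\<^sub>2 a (Poly_Mapping.single j 1))"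
      using N.\<gamma>_mult[OF a_carrier g sp'[OF j]] N.\<gamma>_mult[OF g a_carrier sp'[OF j]] a_commute[OF g] by simp
    then show "\<psi> (\<gamma> g (tensor (Poly_Mapping.single i 1) (Poly_Mapping.single j 1)))
      = scale (\<eta> g) (\<gamma> g (\<psi> (tensor (Poly_Mapping.single i 1) (Poly_Mapping.single j 1))))"
      by (simp add: \<gamma>_tensor \<psi>_tensor M.\<psi>_\<gamma>[OF g sp[OF i]] N.\<psi>_\<gamma>[OF g sp'[OF j]] tensor_scale_left
          tensor_scale_right linmap_add[OF linmap_\<gamma>] pm.scale_right_distrib del: tensor_single)
  qed
  show "act MN h v = lin (\<lambda>(g, l). \<gamma> g ((\<psi> ^^ l) v)) h"
    if h: "h \<in> carrier (H_alg G \<eta>)" and v: "v \<in> space MN" for h v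
  proof -
    have "act MN h v = pair_act (comult G \<eta> a h) v"
      by (simp add: tensor_module_def pair_act_def)
    also have "\<dots> = lin (\<lambda>b. pair_act ((\<lambda>(g, i). tensor (H_grp g) (H_grp g) \<otimes>\<^bsub>HH_alg G \<eta>\<^esub>
        \<Delta>x [^]\<^bsub>HH_alg G \<eta>\<^esub> i) b) v) h"
      unfolding comult_def by (rule linmap_lin_comp[OF linmap_pair_act_left])
    also have "\<dots> = lin (\<lambda>(g, l). \<gamma> g ((\<psi> ^^ l) v)) h"
    proof (rule lin_cong_on[OF h[unfolded carrier_H_alg]])
      fix b assume "b \<in> HB"
      then obtain g and l :: nat where g: "g \<in> carrier G" and b: "b = (g, l)" by auto
      have "tensor (H_grp g) (H_grp g) \<in> (supp_space (HB \<times> HB) :: (_ \<Rightarrow>\<^sub>0 'k) set)"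
        using g by (auto simp: H_grp_def)
      then have "pair_act (tensor (H_grp g) (H_grp g) \<otimes>\<^bsub>HH_alg G \<eta>\<^esub> \<Delta>x [^]\<^bsub>HH_alg G \<eta>\<^esub> l) v = \<gamma> g ((\<psi> ^^ l) v)"
        using pair_act_closed[OF \<Delta>x_pow_closed[of l] v] pair_act_\<Delta>x_pow[OF v, of l]
        by (simp add: pair_act_mult[OF _ \<Delta>x_pow_closed v] pair_act_grp[OF g])
      then show "pair_act ((\<lambda>(g, i). tensor (H_grp g) (H_grp g) \<otimes>\<^bsub>HH_alg G \<eta>\<^esub>
          \<Delta>x [^]\<^bsub>HH_alg G \<eta>\<^esub> i) b) v = (\<lambda>(g, l). \<gamma> g ((\<psi> ^^ l) v)) b"
        by (simp add: b)
    qed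
    finally show ?thesis .
  qed
qed

end

section \<open>Direct sums of representations\<close>

definition incl :: "'r \<Rightarrow> ('i \<Rightarrow>\<^sub>0 'k::field) \<Rightarrow> ('r \<times> 'i \<Rightarrow>\<^sub>0 'k)" where
  "incl r = lin (\<lambda>i. Poly_Mapping.single (r, i) 1)"

definition sum_map ::
  "('r \<Rightarrow> ('i \<Rightarrow>\<^sub>0 'k::field) \<Rightarrow> ('i \<Rightarrow>\<^sub>0 'k)) \<Rightarrow> ('r \<times> 'i \<Rightarrow>\<^sub>0 'k) \<Rightarrow> ('r \<times> 'i \<Rightarrow>\<^sub>0 'k)" where
  "sum_map f = lin (\<lambda>(r, i). incl r (f r (Poly_Mapping.single i 1)))"

lemma linmap_incl [simp]: "linmap (incl r)" and linmap_sum_map [simp]: "linmap (sum_map f)"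
  by (simp_all add: incl_def sum_map_def)

lemma incl_single [simp]: "incl r (Poly_Mapping.single i c) = Poly_Mapping.single (r, i) c"
  by (simp add: incl_def)

lemma sum_map_incl: "linmap (f r) \<Longrightarrow> sum_map f (incl r v) = incl r (f r v)"
  by (rule linmap_eqI[OF linmap_compose[OF linmap_sum_map linmap_incl] linmap_compose[OF linmap_incl]])
     (simp_all add: sum_map_def)

lemma H_rep_direct_sum:
  fixes M :: "'r \<Rightarrow> ('g \<times> nat \<Rightarrow>\<^sub>0 'k::field, 'i, 'k) based_module"
  assumes rep: "\<And>r. r \<in> R \<Longrightarrow> H_rep G \<eta> (M r) (\<gamma> r) (\<psi> r)"
  shows "H_rep G \<eta> (direct_sum R M) (\<lambda>g. sum_map (\<lambda>r. \<gamma> r g)) (sum_map \<psi>)"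
proof
  let ?S = "direct_sum R M"
  have space: "space ?S = supp_space (Sigma R (\<lambda>r. basis (M r)))"
    by (simp add: space_eq direct_sum_def)
  have sp: "Poly_Mapping.single i 1 \<in> space (M r)" if "i \<in> basis (M r)" for r i
    using that by (simp add: space_eq)
  have eqI: "f v = g v" if "linmap f" "linmap g" "v \<in> space ?S"
    "\<And>r i. r \<in> R \<Longrightarrow> i \<in> basis (M r) \<Longrightarrow> f (incl r (Poly_Mapping.single i 1)) = g (incl r (Poly_Mapping.single i 1))"
    for f g :: "('r \<times> 'i \<Rightarrow>\<^sub>0 'k) \<Rightarrow> ('r \<times> 'i \<Rightarrow>\<^sub>0 'k)" and v
    by (rule linmap_eq_on[OF that(1,2) that(3)[unfolded space]]) (use that(4) in auto)
  have incl_closed: "incl r v \<in> space ?S" if "r \<in> R" "v \<in> space (M r)" for r v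
    using that(1) unfolding space
    by (intro linmap_in_subspace[OF linmap_incl _ that(2)[unfolded space_eq]]) auto
  have closed: "sum_map f v \<in> space ?S"
    if "\<And>r v. r \<in> R \<Longrightarrow> v \<in> space (M r) \<Longrightarrow> f r v \<in> space (M r)" "v \<in> space ?S" for f v
    by (rule linmap_in_subspace[OF linmap_sum_map subspace_space that(2)[unfolded space]])
       (auto simp: sum_map_def intro!: incl_closed that(1) sp)
  note ops = H_rep.linmap_\<gamma>[OF rep] H_rep.linmap_\<psi>[OF rep]
  show "sum_map (\<lambda>r. \<gamma> r g) v \<in> space ?S" if "g \<in> carrier G" "v \<in> space ?S" for g v
    by (rule closed[OF _ that(2)]) (use H_rep.\<gamma>_closed[OF rep] that in auto)
  show "sum_map \<psi> v \<in> space ?S" if "v \<in> space ?S" for v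
    by (rule closed[OF _ that]) (use H_rep.\<psi>_closed[OF rep] in auto)
  show "sum_map (\<lambda>r. \<gamma> r \<one>\<^bsub>G\<^esub>) v = v" if "v \<in> space ?S" for v
    by (rule eqI[OF linmap_sum_map linmap_id that])
       (simp add: sum_map_incl ops H_rep.\<gamma>_one[OF rep] sp del: incl_single)
  show "sum_map (\<lambda>r. \<gamma> r (g \<otimes>\<^bsub>G\<^esub> h)) v = sum_map (\<lambda>r. \<gamma> r g) (sum_map (\<lambda>r. \<gamma> r h) v)"
    if "g \<in> carrier G" "h \<in> carrier G" "v \<in> space ?S" for g h v
    by (rule eqI[OF linmap_sum_map linmap_compose[OF linmap_sum_map linmap_sum_map] that(3)])
       (simp add: sum_map_incl ops H_rep.\<gamma>_mult[OF rep] sp that del: incl_single)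
  show "sum_map \<psi> (sum_map (\<lambda>r. \<gamma> r g) v) = scale (\<eta> g) (sum_map (\<lambda>r. \<gamma> r g) (sum_map \<psi> v))"
    if "g \<in> carrier G" "v \<in> space ?S" for g v
    by (rule eqI[OF linmap_compose[OF linmap_sum_map linmap_sum_map]
          linmap_scaled[OF linmap_compose[OF linmap_sum_map linmap_sum_map]] that(2)])
       (simp add: sum_map_incl ops H_rep.\<psi>_\<gamma>[OF rep] sp that linmap_scale[OF linmap_incl] del: incl_single)
  show "act ?S h v = lin (\<lambda>(g, l). sum_map (\<lambda>r. \<gamma> r g) ((sum_map \<psi> ^^ l) v)) h"
    if h: "h \<in> carrier (H_alg G \<eta>)" and v: "v \<in> space ?S" for h v
  proof -
    have "lin (\<lambda>(r, i). incl r (act (M r) h (Poly_Mapping.single i 1))) v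
      = lin (\<lambda>(g, l). sum_map (\<lambda>r. \<gamma> r g) ((sum_map \<psi> ^^ l) v)) h"
    proof (rule eqI[OF linmap_lin _ v])
      show "linmap (\<lambda>v. lin (\<lambda>(g, l). sum_map (\<lambda>r. \<gamma> r g) ((sum_map \<psi> ^^ l) v)) h)"
        by (rule linmap_lin_param) (auto simp: split_beta
            intro: linmap_compose[OF linmap_sum_map linmap_funpow[OF linmap_sum_map]])
      fix r i assume r: "r \<in> R" and i: "i \<in> basis (M r)"
      interpret H_rep G \<eta> "M r" "\<gamma> r" "\<psi> r" using r by (rule rep)
      let ?i = "Poly_Mapping.single i (1::'k)"
      have pow: "(sum_map \<psi> ^^ l) (incl r v) = incl r ((\<psi> r ^^ l) v)" for l v
        by (induction l) (simp_all add: sum_map_incl linmap_\<psi>)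
      have "lin (\<lambda>(r, i). incl r (act (M r) h (Poly_Mapping.single i 1))) (incl r ?i)
        = incl r (act (M r) h ?i)"
        by simp
      also have "\<dots> = incl r (lin (\<lambda>(g, l). \<gamma> r g ((\<psi> r ^^ l) ?i)) h)"
        by (simp only: act_eq[OF h sp[OF i]])
      also have "\<dots> = lin (\<lambda>(g, l). incl r (\<gamma> r g ((\<psi> r ^^ l) ?i))) h"
        by (subst linmap_lin_comp[OF linmap_incl]) (simp add: case_prod_unfold)
      also have "\<dots> = lin (\<lambda>(g, l). sum_map (\<lambda>r. \<gamma> r g) ((sum_map \<psi> ^^ l) (incl r ?i))) h"
        by (simp add: pow sum_map_incl linmap_\<gamma> del: incl_single)
      finally show "lin (\<lambda>(r, i). incl r (act (M r) h (Poly_Mapping.single i 1))) (incl r ?i)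
        = lin (\<lambda>(g, l). sum_map (\<lambda>r. \<gamma> r g) ((sum_map \<psi> ^^ l) (incl r ?i))) h" .
    qed
    then show ?thesis by (simp add: direct_sum_def incl_def)
  qed
qed simp_all

section \<open>Clebsch--Gordan for nilpotent Jordan blocks\<close>

text \<open>This is the d-th finite difference of a polynomial in i of degree A + B < d. The bound
  on \<open>P\<close> keeps the truncated subtraction P - i genuine. One application of Pascal's
  rule trades a d-th difference for a (d-1)-th difference of the first differences, which lowers A
  or B by one.\<close>

lemma sum_alternating_binomial_0:
  fixes d P T A B :: nat
  assumes "A + B < d" "d \<le> P"
  shows "(\<Sum>i\<le>d. (-1) ^ i * int ((d choose i) * (P - i choose A) * (T + i choose B))) = 0"
  using assms
proof (induction d arbitrary: P T A B)
  case 0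
  then show ?case by simp
next
  case (Suc d)
  let ?S = "\<lambda>P T A B. \<Sum>i\<le>d. (-1) ^ i * int ((d choose i) * (P - i choose A) * (T + i choose B))"
  let ?f = "\<lambda>i. int ((P - i choose A) * (T + i choose B))"
  have pascal: "(\<Sum>i\<le>Suc d. (-1) ^ i * int (Suc d choose i) * f i)
    = (\<Sum>i\<le>d. (-1) ^ i * int (d choose i) * (f i - f (Suc i)))" for f :: "nat \<Rightarrow> int"
  proof -
    have "(\<Sum>i\<le>Suc d. (-1) ^ i * int (Suc d choose i) * f i)
      = f 0 + (\<Sum>i\<le>d. (-1) ^ Suc i * int (Suc d choose Suc i) * f (Suc i))"
      by (subst sum.atMost_Suc_shift) simp
    also have "\<dots> = f 0 + (\<Sum>i\<le>d. (-1) ^ Suc i * int (d choose Suc i) * f (Suc i))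
       - (\<Sum>i\<le>d. (-1) ^ i * int (d choose i) * f (Suc i))"
      by (simp add: algebra_simps sum.distrib sum_negf sum_subtractf)
    also have "f 0 + (\<Sum>i\<le>d. (-1) ^ Suc i * int (d choose Suc i) * f (Suc i))
      = (\<Sum>i\<le>Suc d. (-1) ^ i * int (d choose i) * f i)"
      by (subst sum.atMost_Suc_shift) simp
    also have "\<dots> = (\<Sum>i\<le>d. (-1) ^ i * int (d choose i) * f i)"
      by simp
    finally show ?thesis
      by (simp only: sum_subtractf right_diff_distrib)
  qed
  \<comment> \<open>Lowering the index turns P - i into P - Suc i, that is, P into P - 1; the bound
    d \<le> P - 1 is what remains of the hypothesis. The guard on A (and on B below) excludes a
    truncated A - 1, a case in which the term is absent.\<close>
  have A0: "(\<Sum>i\<le>d. (-1) ^ i * int (d choose i) * int ((P - Suc i choose (A - 1)) * (T + i choose B))) = 0" if "A > 0"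
    using Suc.IH[of "A - 1" B "P - 1" T] Suc.prems that by (simp add: mult_ac)
  have B0: "(\<Sum>i\<le>d. (-1) ^ i * int (d choose i) * int ((P - Suc i choose A) * (T + i choose (B - 1)))) = 0" if "B > 0"
    using Suc.IH[of A "B - 1" "P - 1" T] Suc.prems that by (simp add: mult_ac)
  have diff: "?f i - ?f (Suc i) = (if A > 0 then int ((P - Suc i choose (A - 1)) * (T + i choose B)) else 0)
      - (if B > 0 then int ((P - Suc i choose A) * (T + i choose (B - 1))) else 0)" if "i \<le> d" for i
  proof -
    have P: "P - i = Suc (P - Suc i)" using that Suc.prems by simp
    show ?thesis
      unfolding P by (cases A; cases B) (simp_all add: algebra_simps)
  qed
  have "(\<Sum>i\<le>Suc d. (-1) ^ i * int ((Suc d choose i) * (P - i choose A) * (T + i choose B)))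
    = (\<Sum>i\<le>Suc d. (-1) ^ i * int (Suc d choose i) * ?f i)"
    by (intro sum.cong) (simp_all add: mult_ac)
  also have "\<dots> = (\<Sum>i\<le>d. (-1) ^ i * int (d choose i) * (?f i - ?f (Suc i)))"
    by (rule pascal)
  also have "\<dots> = (\<Sum>i\<le>d. (-1) ^ i * int (d choose i) *
      ((if A > 0 then int ((P - Suc i choose (A - 1)) * (T + i choose B)) else 0)
      - (if B > 0 then int ((P - Suc i choose A) * (T + i choose (B - 1))) else 0)))"
    by (intro sum.cong refl) (simp only: diff atMost_iff)
  also have "\<dots> = 0"
    using A0 B0 by (cases "A > 0"; cases "B > 0") (simp_all add: right_diff_distrib sum_subtractf sum_negf)
  finally show ?case .
qed

text \<open>With the lowering operator u^i \<mapsto> i (p - i) u^(i-1), and likewise for v, a vector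
  \<Sum> a_i u^i v^(d-i) in its kernel satisfies a_(i+1) (i+1) (p-i-1) = - a_i (d-i) (t-d+i). These
  numbers, up to the sign (-1)^i, solve the recursion without denominators, so they make sense in
  any commutative ring.\<close>

definition cg_coeff :: "nat \<Rightarrow> nat \<Rightarrow> nat \<Rightarrow> nat \<Rightarrow> nat" where
  "cg_coeff p t d i = (d choose i) * fact (t - d + i - 1) * fact (p - i - 1)"

text \<open>The element of degree \<open>d\<close> in \<open>k[u, v]/(u\<^sup>p, v\<^sup>t)\<close> annihilated by the lowering operator of
  $\mathfrak{sl}_2$; it generates the Jordan block of \<open>u + v\<close> of size \<open>p + t - 1 - 2 d\<close>.\<close>

definition cg_elem :: "nat \<Rightarrow> nat \<Rightarrow> nat \<Rightarrow> 'a \<Rightarrow> 'a \<Rightarrow> 'a::comm_ring_1" where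
  "cg_elem p t d u v = (\<Sum>i\<le>d. (-1) ^ i * of_nat (cg_coeff p t d i) * u ^ i * v ^ (d - i))"

text \<open>The two factorials in \<open>cg_coeff\<close> combine with the denominators of the
  binomial coefficient into two new binomials whose lower indices do not depend on i. They are
  polynomials in i of degrees p-1-e and e+d-p, adding up to d-1.\<close>

lemma cg_coeff_binomial:
  assumes "i \<le> d" "d < p" "d < t" "p - d \<le> e" "e < p" "i \<le> e"
  shows "cg_coeff p t d i * (p + t - 1 - 2 * d choose (e - i))
    = fact (p + t - 1 - 2 * d) * fact (p - 1 - e) * fact (e + d - p) *
      ((d choose i) * (p - 1 - i choose (p - 1 - e)) * (t - d - 1 + i choose (e + d - p)))"
proof (cases "p + t - 1 - 2 * d < e - i")
  case True
  \<comment> \<open>Outside the range of the binomial on the left, the last binomial on the right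
    vanishes as well.\<close>
  then have "t - d - 1 + i < e + d - p" using assms by linarith
  with True show ?thesis by (simp add: binomial_eq_0)
next
  case False
  define n where "n = p + t - 1 - 2 * d"
  have 1: "fact (e - i) * fact (n - (e - i)) * (n choose (e - i)) = fact n"
    using False by (intro binomial_fact_lemma) (simp add: n_def)
  have 2: "fact (p - 1 - e) * fact (e - i) * (p - 1 - i choose (p - 1 - e)) = fact (p - i - 1)"
    using binomial_fact_lemma[of "p - 1 - e" "p - 1 - i"] assms
    by (simp add: algebra_simps)
  have "e + d - p \<le> t - d - 1 + i" "t - d - 1 + i - (e + d - p) = n - (e - i)"
    using False assms by (simp_all add: n_def)
  then have 3: "fact (e + d - p) * fact (n - (e - i)) * (t - d - 1 + i choose (e + d - p)) = fact (t - d + i - 1)"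
    using binomial_fact_lemma[of "e + d - p" "t - d - 1 + i"] assms
    by (simp add: algebra_simps)
  have "fact (e - i) * fact (n - (e - i)) * (cg_coeff p t d i * (n choose (e - i)))
    = (d choose i) * fact (t - d + i - 1) * fact (p - i - 1) * (fact (e - i) * fact (n - (e - i)) * (n choose (e - i)))"
    by (simp add: cg_coeff_def mult_ac)
  also have "\<dots> = fact (e - i) * fact (n - (e - i)) *
      (fact n * fact (p - 1 - e) * fact (e + d - p) *
      ((d choose i) * (p - 1 - i choose (p - 1 - e)) * (t - d - 1 + i choose (e + d - p))))"
    unfolding 1 2[symmetric] 3[symmetric] by (simp add: mult_ac)
  finally show ?thesis unfolding n_def[symmetric] by simp
qed

text \<open>The sum is the coefficient of u^e in the product of (u + v)^(p+t-1-2d) with the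
  generator of degree d. Up to a constant it is a d-th difference of a polynomial of degree d -
  1.\<close>

lemma cg_coeff_sum_0:
  assumes "d < p" "d < t" "p - d \<le> e" "e < p"
  shows "(\<Sum>i\<le>d. (-1) ^ i * int (cg_coeff p t d i * (if i \<le> e then (p + t - 1 - 2 * d choose (e - i)) else 0))) = 0"
proof -
  let ?c = "fact (p + t - 1 - 2 * d) * fact (p - 1 - e) * fact (e + d - p) :: nat"
  have "(-1) ^ i * int (cg_coeff p t d i * (if i \<le> e then (p + t - 1 - 2 * d choose (e - i)) else 0))
    = int ?c * ((-1) ^ i * int ((d choose i) * (p - 1 - i choose (p - 1 - e)) * (t - d - 1 + i choose (e + d - p))))"
    if "i \<le> d" for i
  proof (cases "i \<le> e")
    case True
    then show ?thesis using cg_coeff_binomial[OF that assms True] by (simp add: mult_ac)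
  next
    case False
    \<comment> \<open>For i > e the left side is 0 by its case distinction, and the right side
      because its second binomial is out of range.\<close>
    then have "p - 1 - i < p - 1 - e" using that assms by linarith
    with False show ?thesis by (simp add: binomial_eq_0)
  qed
  then have "(\<Sum>i\<le>d. (-1) ^ i * int (cg_coeff p t d i * (if i \<le> e then (p + t - 1 - 2 * d choose (e - i)) else 0)))
    = int ?c * (\<Sum>i\<le>d. (-1) ^ i * int ((d choose i) * (p - 1 - i choose (p - 1 - e)) * (t - d - 1 + i choose (e + d - p))))"
    unfolding sum_distrib_left by (intro sum.cong) auto
  also have "\<dots> = 0"
    using sum_alternating_binomial_0[of "p - 1 - e" "e + d - p" d "p - 1" "t - d - 1"] assms by simp
  finally show ?thesis .
qed

text \<open>The product is sorted by the exponent e of u. For e \<ge> p the monomial is divisible by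
  u^p, for e < p - d the exponent of v is at least t, and in the window between them the coefficient
  vanishes by \<open>cg_coeff_sum_0\<close>.\<close>

lemma cg_elem_annihilated:
  fixes u v :: "'a::comm_ring_1"
  assumes d: "d < p" "d < t"
  shows "\<exists>f g. (u + v) ^ (p + t - 1 - 2 * d) * cg_elem p t d u v = u ^ p * f + v ^ t * g"
proof -
  define n where "n = p + t - 1 - 2 * d"
  define I where "I = {u ^ p * f + v ^ t * g |f g. True}"
  define c :: "nat \<Rightarrow> nat \<Rightarrow> int"
    where "c e i = (-1) ^ i * int (cg_coeff p t d i * (if i \<le> e then (n choose (e - i)) else 0))" for e i
  have I0: "0 \<in> I" unfolding I_def by (auto intro!: exI[of _ 0])
  have I_add: "x + y \<in> I" if "x \<in> I" "y \<in> I" for x y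
  proof -
    from that obtain f g f' g' where "x = u ^ p * f + v ^ t * g" "y = u ^ p * f' + v ^ t * g'"
      unfolding I_def by blast
    then have "x + y = u ^ p * (f + f') + v ^ t * (g + g')" by (simp add: algebra_simps)
    then show ?thesis unfolding I_def by blast
  qed
  have I_sum: "(\<Sum>x\<in>A. h x) \<in> I" if "\<And>x. x \<in> A \<Longrightarrow> h x \<in> I" for h and A :: "nat set"
    using that by (induction A rule: infinite_finite_induct) (auto simp: I0 I_add)
  have "u ^ p * f = u ^ p * f + v ^ t * 0" for f by simp
  then have Iu: "u ^ p * f \<in> I" for f unfolding I_def by blast
  have "v ^ t * f = u ^ p * 0 + v ^ t * f" for f by simp
  then have Iv: "v ^ t * f \<in> I" for f unfolding I_def by blast
  have binom: "(u + v) ^ n * (u ^ i * v ^ (d - i))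
      = (\<Sum>e\<le>n + d. of_nat (if i \<le> e then n choose (e - i) else 0) * (u ^ e * v ^ (n + d - e)))" if "i \<le> d" for i
  proof -
    have "(u + v) ^ n * (u ^ i * v ^ (d - i))
        = (\<Sum>j\<le>n. of_nat (n choose j) * (u ^ (j + i) * v ^ (n + d - (j + i))))"
    proof -
      have "v ^ (n - j) * v ^ (d - i) = v ^ (n + d - (j + i))" if "j \<le> n" for j
        using that \<open>i \<le> d\<close> by (simp add: power_add[symmetric])
      then show ?thesis
        unfolding binomial_ring sum_distrib_right
        by (intro sum.cong refl) (simp add: power_add mult_ac)
    qed
    also have "\<dots> = (\<Sum>e\<in>(\<lambda>j. j + i) ` {..n}. of_nat (n choose (e - i)) * (u ^ e * v ^ (n + d - e)))"
      by (subst sum.reindex) (auto simp: inj_on_def)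
    also have "\<dots> = (\<Sum>e\<le>n + d. of_nat (if i \<le> e then n choose (e - i) else 0) * (u ^ e * v ^ (n + d - e)))"
    proof (rule sum.mono_neutral_cong_left)
      show "(\<lambda>j. j + i) ` {..n} \<subseteq> {..n + d}" using that by auto
      show "\<forall>e\<in>{..n + d} - (\<lambda>j. j + i) ` {..n}.
        of_nat (if i \<le> e then n choose (e - i) else 0) * (u ^ e * v ^ (n + d - e)) = 0"
      proof
        fix e assume e: "e \<in> {..n + d} - (\<lambda>j. j + i) ` {..n}"
        have "n < e - i" if "i \<le> e"
        proof (rule ccontr)
          assume "\<not> n < e - i"
          then have "e \<in> (\<lambda>j. j + i) ` {..n}" using that by (intro image_eqI[of _ _ "e - i"]) auto
          then show False using e by simp
        qed
        then show "of_nat (if i \<le> e then n choose (e - i) else 0) * (u ^ e * v ^ (n + d - e)) = 0"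
          by (simp add: binomial_eq_0)
      qed
    qed auto
    finally show ?thesis .
  qed
  have "(u + v) ^ n * cg_elem p t d u v
    = (\<Sum>i\<le>d. (-1) ^ i * of_nat (cg_coeff p t d i) * ((u + v) ^ n * (u ^ i * v ^ (d - i))))"
    unfolding cg_elem_def by (simp add: sum_distrib_left mult_ac)
  also have "\<dots> = (\<Sum>i\<le>d. \<Sum>e\<le>n + d. of_int (c e i) * (u ^ e * v ^ (n + d - e)))"
  proof (rule sum.cong[OF refl])
    fix i assume "i \<in> {..d}"
    then show "(-1) ^ i * of_nat (cg_coeff p t d i) * ((u + v) ^ n * (u ^ i * v ^ (d - i)))
      = (\<Sum>e\<le>n + d. of_int (c e i) * (u ^ e * v ^ (n + d - e)))"
      by (subst binom) (auto simp: c_def sum_distrib_left mult_ac intro!: sum.cong)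
  qed
  also have "\<dots> = (\<Sum>e\<le>n + d. of_int (\<Sum>i\<le>d. c e i) * (u ^ e * v ^ (n + d - e)))"
    by (subst sum.swap) (simp add: sum_distrib_right)
  also have "\<dots> \<in> I"
  proof (rule I_sum)
    fix e assume "e \<in> {..n + d}"
    consider "e \<ge> p" | "e < p - d" | "p - d \<le> e" "e < p" by linarith
    then show "of_int (\<Sum>i\<le>d. c e i) * (u ^ e * v ^ (n + d - e)) \<in> I"
    proof cases
      case 1
      then have "u ^ e = u ^ p * u ^ (e - p)" by (simp add: power_add[symmetric])
      then show ?thesis
        using Iu[of "u ^ (e - p) * v ^ (n + d - e) * of_int (\<Sum>i\<le>d. c e i)"] by (simp add: mult_ac)
    next
      case 2
      then have "t \<le> n + d - e" using d by (simp add: n_def)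
      then have "v ^ (n + d - e) = v ^ t * v ^ (n + d - e - t)"
        by (metis le_add_diff_inverse power_add)
      then show ?thesis
        using Iv[of "v ^ (n + d - e - t) * u ^ e * of_int (\<Sum>i\<le>d. c e i)"] by (simp add: mult_ac)
    next
      case 3
      have "(\<Sum>i\<le>d. c e i) = 0"
        unfolding c_def n_def by (rule cg_coeff_sum_0[OF d 3])
      then show ?thesis using I0 by (simp only: of_int_0 mult_zero_left)
    qed
  qed
  finally show ?thesis unfolding I_def n_def by blast
qed

section \<open>The $q$-binomial theorem\<close>

text \<open>Defined by a Pascal rule instead of a quotient of q-factorials, since those vanish at
  the roots of unity of interest.\<close>

fun gauss_binomial :: "'k::field \<Rightarrow> nat \<Rightarrow> nat \<Rightarrow> 'k" where
  "gauss_binomial q n 0 = 1"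
| "gauss_binomial q 0 (Suc k) = 0"
| "gauss_binomial q (Suc n) (Suc k) = gauss_binomial q n (Suc k) + q ^ (n - k) * gauss_binomial q n k"

lemma gauss_binomial_eq_0: "n < k \<Longrightarrow> gauss_binomial q n k = 0"
  by (induction q n k rule: gauss_binomial.induct) auto

lemma gauss_binomial_self: "gauss_binomial q n n = 1"
  by (induction n) (auto simp: gauss_binomial_eq_0)

text \<open>The q-analogue of (k+1) C(n, k+1) = (n-k) C(n, k). It replaces the product formula and
  holds for every q.\<close>

lemma gauss_binomial_absorb:
  "k \<le> n \<Longrightarrow> (1 - q ^ Suc k) * gauss_binomial q n (Suc k) = (1 - q ^ (n - k)) * gauss_binomial q n k"
proof (induction n arbitrary: k)
  case 0
  then show ?case by simp
next
  case (Suc n)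
  show ?case
  proof (cases "k = Suc n")
    case True
    then show ?thesis by (simp add: gauss_binomial_eq_0)
  next
    case False
    then have k: "k \<le> n" using Suc.prems by simp
    have "(1 - q ^ Suc k) * gauss_binomial q (Suc n) (Suc k)
      = (1 - q ^ (n - k)) * gauss_binomial q n k + (1 - q ^ Suc k) * q ^ (n - k) * gauss_binomial q n k"
      by (simp only: gauss_binomial.simps distrib_left Suc.IH[OF k] mult.assoc)
    also have "\<dots> = (1 - q ^ (Suc k + (n - k))) * gauss_binomial q n k"
      by (simp add: algebra_simps power_add)
    finally have L: "(1 - q ^ Suc k) * gauss_binomial q (Suc n) (Suc k) = (1 - q ^ Suc n) * gauss_binomial q n k"
      using k by simp
    show ?thesis
    proof (cases k)
      case 0
      then show ?thesis using L by simp
    next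
      case (Suc j)
      have nj: "n - j = Suc n - k" "Suc n = (Suc n - k) + k" using Suc k by auto
      have "(1 - q ^ (Suc n - k)) * gauss_binomial q (Suc n) k
        = (1 - q ^ (n - j)) * gauss_binomial q n k + q ^ (n - j) * ((1 - q ^ (n - j)) * gauss_binomial q n j)"
        using nj(1) by (simp add: Suc algebra_simps)
      also have "\<dots> = (1 - q ^ (n - j)) * gauss_binomial q n k + q ^ (n - j) * ((1 - q ^ k) * gauss_binomial q n k)"
        using Suc.IH[of j] k Suc by simp
      also have "\<dots> = (1 - q ^ (n - j + k)) * gauss_binomial q n k"
        by (simp add: algebra_simps power_add)
      also have "n - j + k = Suc n" using nj by simp
      finally show ?thesis using L by simp
    qed
  qed
qed

text \<open>The absorption identity climbs from k to k + 1: it starts with 1 - q^s = 0, and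
  primitivity allows the factor 1 - q^(k+1) to be cancelled as long as k + 1 < s.\<close>

lemma gauss_binomial_root_of_unity:
  assumes "primitive_root_of_unity s q" "0 < k" "k < s"
  shows "gauss_binomial q s k = 0"
proof -
  have "gauss_binomial q s (Suc j) = 0" if "Suc j < s" for j
    using that
  proof (induction j)
    case 0
    have "(1 - q) * gauss_binomial q s 1 = 1 - q ^ s"
      using gauss_binomial_absorb[of 0 s q] by simp
    moreover have "q ^ s = 1" "q \<noteq> 1"
      using assms(1) 0 unfolding primitive_root_of_unity_def by (auto dest: spec[of _ 1])
    ultimately show ?case by simp
  next
    case (Suc j)
    then have "(1 - q ^ Suc (Suc j)) * gauss_binomial q s (Suc (Suc j)) = 0"
      using gauss_binomial_absorb[of "Suc j" s q] by simp
    moreover have "q ^ Suc (Suc j) \<noteq> 1"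
      using assms(1) Suc.prems unfolding primitive_root_of_unity_def by blast
    ultimately show ?case by (simp del: power_Suc)
  qed
  then show ?thesis using assms(2,3) by (cases k) auto
qed

text \<open>The commutation rule is assumed only on an invariant set \<open>S\<close>, because the
  module laws hold only on the space of the module. Powers of \<open>V\<close> are kept to the left,
  so a new factor \<open>U\<close> must pass n - k of them; this is the power of q in the Pascal
  rule.\<close>

lemma q_binomial_theorem:
  fixes U V :: "('b \<Rightarrow>\<^sub>0 'k::field) \<Rightarrow> ('b \<Rightarrow>\<^sub>0 'k)"
  assumes U: "linmap U" and V: "linmap V"
    and closed: "\<And>w. w \<in> S \<Longrightarrow> U w \<in> S" "\<And>w. w \<in> S \<Longrightarrow> V w \<in> S"
    and comm: "\<And>w. w \<in> S \<Longrightarrow> U (V w) = scale q (V (U w))" and w: "w \<in> S"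
  shows "((\<lambda>w. U w + V w) ^^ n) w = (\<Sum>k\<le>n. scale (gauss_binomial q n k) ((V ^^ (n - k)) ((U ^^ k) w)))"
proof (induction n)
  case 0
  then show ?case by simp
next
  case (Suc n)
  have closed_pow: "(U ^^ k) w \<in> S" "(V ^^ k) x \<in> S" if "x \<in> S" for k x
    using closed w that by (induction k) auto
  have comm_pow: "U ((V ^^ k) x) = scale (q ^ k) ((V ^^ k) (U x))" if "x \<in> S" for k x
  proof (induction k)
    case (Suc k)
    then show ?case using comm[OF closed_pow(2)[OF that]] by (simp add: linmap_scale[OF V])
  qed simp
  let ?T = "\<lambda>m k. (V ^^ m) ((U ^^ k) w)"
  have UT: "U (?T m k) = scale (q ^ m) (?T m (Suc k))" for m k
    using comm_pow[OF closed_pow(1)[OF w]] by simp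
  have "((\<lambda>w. U w + V w) ^^ Suc n) w
    = (\<Sum>k\<le>n. scale (gauss_binomial q n k) (U (?T (n - k) k))) + (\<Sum>k\<le>n. scale (gauss_binomial q n k) (V (?T (n - k) k)))"
    using Suc.IH by (simp add: linmap_sum[OF U] linmap_sum[OF V] linmap_scale[OF U] linmap_scale[OF V])
  also have "(\<Sum>k\<le>n. scale (gauss_binomial q n k) (U (?T (n - k) k)))
    = (\<Sum>k\<le>n. scale (q ^ (n - k) * gauss_binomial q n k) (?T (Suc n - Suc k) (Suc k)))"
    by (simp add: UT mult.commute)
  \<comment> \<open>The added term k = n + 1 is zero; with it, removing the term k = 0 aligns this
    sum with the other one.\<close>
  also have "(\<Sum>k\<le>n. scale (gauss_binomial q n k) (V (?T (n - k) k)))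
    = (\<Sum>k\<le>Suc n. scale (gauss_binomial q n k) (?T (Suc n - k) k))"
    by (simp add: gauss_binomial_eq_0 Suc_diff_le)
  also have "\<dots> = ?T (Suc n) 0 + (\<Sum>k\<le>n. scale (gauss_binomial q n (Suc k)) (?T (Suc n - Suc k) (Suc k)))"
    by (subst sum.atMost_Suc_shift) simp
  finally have "((\<lambda>w. U w + V w) ^^ Suc n) w = ?T (Suc n) 0 +
      ((\<Sum>k\<le>n. scale (q ^ (n - k) * gauss_binomial q n k) (?T (Suc n - Suc k) (Suc k))) +
      (\<Sum>k\<le>n. scale (gauss_binomial q n (Suc k)) (?T (Suc n - Suc k) (Suc k))))"
    by (simp only: add_ac)
  also have "\<dots> = ?T (Suc n) 0 + (\<Sum>k\<le>n. scale (gauss_binomial q (Suc n) (Suc k)) (?T (Suc n - Suc k) (Suc k)))"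
    by (simp add: sum.distrib[symmetric] pm.scale_left_distrib[symmetric] add.commute)
  also have "\<dots> = (\<Sum>k\<le>Suc n. scale (gauss_binomial q (Suc n) k) (?T (Suc n - k) k))"
    by (subst sum.atMost_Suc_shift) simp
  finally show ?case .
qed

lemma q_binomial_root_of_unity:
  fixes U V :: "('b \<Rightarrow>\<^sub>0 'k::field) \<Rightarrow> ('b \<Rightarrow>\<^sub>0 'k)"
  assumes "linmap U" "linmap V"
    and "\<And>w. w \<in> S \<Longrightarrow> U w \<in> S" "\<And>w. w \<in> S \<Longrightarrow> V w \<in> S"
    and "\<And>w. w \<in> S \<Longrightarrow> U (V w) = scale q (V (U w))" and "w \<in> S"
    and q: "primitive_root_of_unity s q"
  shows "((\<lambda>w. U w + V w) ^^ s) w = (U ^^ s) w + (V ^^ s) w"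
proof -
  have s: "s > 0" using q by (simp add: primitive_root_of_unity_def)
  have "((\<lambda>w. U w + V w) ^^ s) w = (\<Sum>k\<le>s. scale (gauss_binomial q s k) ((V ^^ (s - k)) ((U ^^ k) w)))"
    by (rule q_binomial_theorem[OF assms(1-6)])
  also have "\<dots> = (\<Sum>k\<in>{0, s}. scale (gauss_binomial q s k) ((V ^^ (s - k)) ((U ^^ k) w)))"
    using gauss_binomial_root_of_unity[OF q] by (intro sum.mono_neutral_right) auto
  also have "\<dots> = (U ^^ s) w + (V ^^ s) w"
    using s by (simp add: gauss_binomial_self)
  finally show ?thesis .
qed

section \<open>Cyclic structure of $V_n(\mu, \beta)$\<close>

text \<open>Otherwise the basis vector $m_0$, which is \<open>Poly_Mapping.single 0 1\<close>, would be rewritten to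
  the unit of the monoid algebra.\<close>

declare single_one [simp del]

lemma scale_eq_mult: "scale c f = Poly_Mapping.single 0 c * f"
  by (simp add: scale_def mult_map_scale_conv_mult)

lemma scale_mult:
  fixes f g :: "'b::comm_monoid_add \<Rightarrow>\<^sub>0 'k::field"
  shows "scale c f * g = scale c (f * g)" "f * scale c g = scale c (f * g)"
  by (simp_all add: scale_eq_mult mult_ac)

lemma linmap_mult_left: "linmap (\<lambda>f :: 'b::comm_monoid_add \<Rightarrow>\<^sub>0 'k::field. h * f)"
  by (rule linmapI) (simp_all add: distrib_left scale_mult)

text \<open>Transfers the defining identity of the \<alpha>_j from univariate polynomials to the
  monoid algebra. It is applied with y = x_1^s, y = x_2^s and y = \<open>Z\<close>.\<close>

lemma power_diff_const_expand:
  fixes y :: "'b::comm_monoid_add \<Rightarrow>\<^sub>0 'k::field"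
  shows "(y - Poly_Mapping.single 0 \<beta>) ^ n = y ^ n - (\<Sum>j<n. scale (V_coeff n \<beta> j) (y ^ j))"
proof -
  have \<kappa>: "of_nat m * Poly_Mapping.single 0 (- \<beta>) ^ l = (Poly_Mapping.single 0 (of_nat m * (- \<beta>) ^ l) :: 'b \<Rightarrow>\<^sub>0 'k)" for m l
    by (induction l) (simp_all add: mult_single mult_ac single_of_nat[symmetric] del: single_of_nat)
  have "(y - Poly_Mapping.single 0 \<beta>) ^ n = (y + Poly_Mapping.single 0 (- \<beta>)) ^ n"
    by (simp add: single_uminus)
  also have "\<dots> = (\<Sum>j\<le>n. (of_nat (n choose j) * Poly_Mapping.single 0 (- \<beta>) ^ (n - j)) * y ^ j)"
    unfolding binomial_ring by (simp add: mult_ac)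
  also have "\<dots> = (\<Sum>j\<le>n. scale (- V_coeff n \<beta> j) (y ^ j))"
    unfolding \<kappa> scale_eq_mult V_coeff_def
    by (simp add: coeff_linear_poly_power)
  also have "\<dots> = (\<Sum>j<n. scale (- V_coeff n \<beta> j) (y ^ j)) + scale (- V_coeff n \<beta> n) (y ^ n)"
    by (simp add: lessThan_Suc_atMost[symmetric])
  \<comment> \<open>The formula for the coefficients also makes sense at the top index, where it is
    minus the leading coefficient; this term is the isolated y^n.\<close>
  also have "V_coeff n \<beta> n = -1"
    by (simp add: V_coeff_def coeff_linear_poly_power)
  finally show ?thesis by (simp add: sum_negf)
qed

lemma V_x_funpow:
  "i < n * s \<Longrightarrow> (V_x s n \<beta> ^^ i) (Poly_Mapping.single 0 1) = Poly_Mapping.single i 1"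
  by (induction i) (simp_all add: V_x_def)

text \<open>In other words (x^s - \<beta>)^n kills m_0, the single relation that presents V_n as a
  cyclic module over x.\<close>

lemma V_x_funpow_top:
  assumes "n > 0" "s > 0"
  shows "(V_x s n \<beta> ^^ (n * s)) (Poly_Mapping.single 0 1)
    = (\<Sum>j<n. scale (V_coeff n \<beta> j) ((V_x s n \<beta> ^^ (j * s)) (Poly_Mapping.single 0 1)))"
proof -
  obtain m where m: "n * s = Suc m" using assms by (metis gr0_implies_Suc nat_0_less_mult_iff)
  then have "(V_x s n \<beta> ^^ (n * s)) (Poly_Mapping.single 0 1) = V_x s n \<beta> (Poly_Mapping.single m 1)"
    using V_x_funpow[of m n s \<beta>] by simp
  also have "\<dots> = (\<Sum>j<n. Poly_Mapping.single (j * s) (V_coeff n \<beta> j))"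
    using m by (simp add: V_x_def)
  also have "\<dots> = (\<Sum>j<n. scale (V_coeff n \<beta> j) ((V_x s n \<beta> ^^ (j * s)) (Poly_Mapping.single 0 1)))"
    using assms(2) by (intro sum.cong refl) (simp add: V_x_funpow)
  finally show ?thesis .
qed

text \<open>The mapping property of V_n: a vector \<open>w\<close> killed by (\<psi>^s - \<beta>)^n
  receives a map m_l \<mapsto> \<psi>^l w that commutes with x. The hypothesis on \<open>w\<close>
  is consumed at the last basis vector, where x wraps around.\<close>

lemma lin_funpow_V_x:
  fixes \<psi> :: "('b \<Rightarrow>\<^sub>0 'k::field) \<Rightarrow> ('b \<Rightarrow>\<^sub>0 'k)"
  assumes l: "l < n * s"
    and w: "(\<psi> ^^ (n * s)) w = (\<Sum>j<n. scale (V_coeff n \<beta> j) ((\<psi> ^^ (j * s)) w))"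
  shows "lin (\<lambda>l. (\<psi> ^^ l) w) (V_x s n \<beta> (Poly_Mapping.single l 1)) = \<psi> ((\<psi> ^^ l) w)"
proof (cases "l + 1 < n * s")
  case True
  then show ?thesis by (simp add: V_x_def)
next
  case False
  with l have "n * s = Suc l" by simp
  then have "\<psi> ((\<psi> ^^ l) w) = (\<psi> ^^ (n * s)) w" by simp
  with False show ?thesis by (simp add: V_x_def w linmap_sum[OF linmap_lin])
qed

section \<open>The tensor product as a quotient of a polynomial ring\<close>

text \<open>With m = min p t and r = |p - t| the right side is min p t * max p t = p t, the number
  required by the dimension count.\<close>

lemma sum_block_sizes:
  "(\<Sum>j=1..m. 2 * j - 1 + r) = m * (m + r :: nat)"
  by (induction m) (auto simp: algebra_simps)

locale tensor_V =
  fixes G :: "('g, 'm) monoid_scheme" (structure)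
    and a :: 'g and \<chi> \<sigma> \<mu> :: "'g \<Rightarrow> 'k::field_char_0" and \<alpha> \<beta> :: 'k and p t s :: nat
    and \<eta> :: "'g \<Rightarrow> 'k"
  assumes G: "group G" and a: "a \<in> center G"
    and \<chi>: "\<chi> \<in> carrier (character_group G)"
    and ord: "group.ord (character_group G) \<chi> = s" and s: "s > 0"
    and root: "primitive_root_of_unity s (\<eta> a)"
    and p: "p \<ge> 1" and t: "t \<ge> 1"
    and \<sigma>: "\<sigma> \<in> carrier (character_group G)" and \<mu>: "\<mu> \<in> carrier (character_group G)"
    and \<eta>_eq: "\<eta> = inv\<^bsub>character_group G\<^esub> \<chi>"
begin

sublocale G: group G by (rule G)

sublocale C: group "character_group G :: ('g \<Rightarrow> 'k) monoid"
  by (rule group_character_group) (rule G)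

lemma \<eta>_inverse: "g \<in> carrier G \<Longrightarrow> \<eta> g = inverse (\<chi> g)"
  by (simp add: \<eta>_eq inv_character_group[OF G \<chi>])

lemma \<chi>_nonzero: "g \<in> carrier G \<Longrightarrow> \<chi> g \<noteq> 0"
  using carrier_character_groupD(2)[OF \<chi>] by blast

lemma \<eta>_carrier: "\<eta> \<in> carrier (character_group G)"
  unfolding \<eta>_eq using \<chi> by simp

lemma a_carrier: "a \<in> carrier G"
  using a by (simp add: center_def)

lemma \<chi>_pow_s: "g \<in> carrier G \<Longrightarrow> \<chi> g ^ s = 1"
  using C.pow_ord_eq_1[OF \<chi>] by (simp add: ord pow_character_group[symmetric] one_character_group)

lemma ring: "ring (H_alg G \<eta>)"
  using ring_H_alg[OF G] carrier_character_groupD(1)[OF \<eta>_carrier] character_one[OF G \<eta>_carrier] by blast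

text \<open>The two summands of the action of x commute up to \<open>\<chi> a\<close>, the inverse
  of the given root of unity, so primitivity has to be passed to the inverse.\<close>

lemma root_\<chi>: "primitive_root_of_unity s (\<chi> a)"
proof -
  have "\<chi> a ^ m = 1 \<longleftrightarrow> \<eta> a ^ m = 1" for m
    by (simp add: \<eta>_inverse[OF a_carrier] power_inverse)
  then show ?thesis using root by (simp add: primitive_root_of_unity_def)
qed

abbreviation "X \<equiv> V_x s p \<alpha>"
abbreviation "Y \<equiv> V_x s t \<beta>"

lemma rep_V: "\<mu>' \<in> carrier (character_group G) \<Longrightarrow> H_rep G \<eta> (V G \<chi> n \<mu>' b) (V_grp \<chi> \<mu>') (V_x s n b)"
  using \<eta>_inverse by (intro H_rep_V[OF G \<chi>]) (auto simp: ord s)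

sublocale T: H_rep_pair G \<eta> "V G \<chi> p \<sigma> \<alpha>" "V_grp \<chi> \<sigma>" X "V G \<chi> t \<mu> \<beta>" "V_grp \<chi> \<mu>" Y a
  by (intro H_rep_pair.intro rep_V \<sigma> \<mu> G H_rep_pair_axioms.intro a)

sublocale H_rep G \<eta> "tensor_module G \<eta> a (V G \<chi> p \<sigma> \<alpha>) (V G \<chi> t \<mu> \<beta>)" T.\<gamma> T.\<psi>
  by (rule T.H_rep_tensor)

lemma basis_V: "basis (V G \<chi> n \<mu>' b) = {..<n * s}"
  by (simp add: V_def ord Let_def)

lemma space_V: "space (V G \<chi> n \<mu>' b) = supp_space {..<n * s}"
  by (simp add: space_eq basis_V)

lemma space_MN: "space T.MN = supp_space ({..<p * s} \<times> {..<t * s})"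
  by (simp add: space_tensor_module basis_V)

abbreviation "e\<^sub>1 i \<equiv> (X ^^ i) (Poly_Mapping.single 0 1)"
abbreviation "e\<^sub>2 j \<equiv> (Y ^^ j) (Poly_Mapping.single 0 1)"

lemma e_closed: "e\<^sub>1 i \<in> supp_space {..<p * s}" "e\<^sub>2 j \<in> supp_space {..<t * s}"
  using T.M.\<psi>_funpow_closed[of "Poly_Mapping.single 0 1" i] T.N.\<psi>_funpow_closed[of "Poly_Mapping.single 0 1" j] p t s
  by (auto simp: space_V)

text \<open>The exponent i is unrestricted: beyond ns - 1 the vector is no longer a basis vector, so
  its character is derived from the commutation rule.\<close>

lemma V_grp_funpow:
  assumes \<mu>': "\<mu>' \<in> carrier (character_group G)" and g: "g \<in> carrier G" and n: "n \<ge> 1"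
  shows "V_grp \<chi> \<mu>' g ((V_x s n b ^^ i) (Poly_Mapping.single 0 1))
    = scale (\<chi> g ^ i * \<mu>' g) ((V_x s n b ^^ i) (Poly_Mapping.single 0 1))"
proof -
  interpret W: H_rep G \<eta> "V G \<chi> n \<mu>' b" "V_grp \<chi> \<mu>'" "V_x s n b" by (rule rep_V) fact
  have "scale (\<mu>' g) ((V_x s n b ^^ i) (Poly_Mapping.single 0 1))
      = (V_x s n b ^^ i) (V_grp \<chi> \<mu>' g (Poly_Mapping.single 0 1))"
    using linmap_scale[OF linmap_funpow[OF linmap_V_x], of i s n b "\<mu>' g" "Poly_Mapping.single 0 1"] by simp
  also have "\<dots> = scale (\<eta> g ^ i) (V_grp \<chi> \<mu>' g ((V_x s n b ^^ i) (Poly_Mapping.single 0 1)))"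
    using n s by (intro W.\<psi>_funpow_\<gamma> g) (simp add: space_V)
  finally have "scale (\<chi> g ^ i) (scale (\<mu>' g) ((V_x s n b ^^ i) (Poly_Mapping.single 0 1)))
      = scale (\<chi> g ^ i * \<eta> g ^ i) (V_grp \<chi> \<mu>' g ((V_x s n b ^^ i) (Poly_Mapping.single 0 1)))"
    by simp
  also have "\<chi> g ^ i * \<eta> g ^ i = 1"
    using \<chi>_nonzero[OF g] by (simp add: \<eta>_inverse[OF g] power_mult_distrib[symmetric])
  finally show ?thesis by simp
qed

text \<open>The monoid algebra of \<open>nat \<times> nat\<close> serves as the polynomial ring in two variables; \<open>\<Phi>\<close>
  sends $x_1^i x_2^j$ to $x^i m_0 \otimes x^j m_0$.\<close>

definition \<Phi> :: "(nat \<times> nat \<Rightarrow>\<^sub>0 'k) \<Rightarrow> (nat \<times> nat \<Rightarrow>\<^sub>0 'k)" where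
  "\<Phi> = lin (\<lambda>(i, j). tensor (e\<^sub>1 i) (e\<^sub>2 j))"

definition mon :: "nat \<Rightarrow> nat \<Rightarrow> (nat \<times> nat \<Rightarrow>\<^sub>0 'k)" where
  "mon i j = Poly_Mapping.single (i, j) 1"

lemma linmap_\<Phi> [simp]: "linmap \<Phi>"
  by (simp add: \<Phi>_def)

lemma \<Phi>_mon: "\<Phi> (mon i j) = tensor (e\<^sub>1 i) (e\<^sub>2 j)"
  by (simp add: \<Phi>_def mon_def)

lemma mon_mult: "mon i j * mon k l = mon (i + k) (j + l)"
  by (simp add: mon_def mult_single)

lemma mon_power: "mon i j ^ n = mon (i * n) (j * n)"
proof (induction n)
  case 0
  have "mon 0 0 = 1"
    unfolding mon_def by (simp add: zero_prod_def[symmetric] single_one)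
  then show ?case by simp
qed (simp add: mon_mult add_ac)

lemma mon_eqI:
  assumes "linmap f" "linmap g" "\<And>i j. f (mon i j) = g (mon i j)"
  shows "f h = g h"
  by (rule linmap_eqI[OF assms(1,2)]) (use assms(3) in \<open>auto simp: mon_def\<close>)

lemma \<Phi>_closed: "\<Phi> f \<in> space T.MN"
  unfolding \<Phi>_def space_MN
  by (rule lin_in_subspace[of _ _ UNIV]) (auto simp: supp_space_def[of UNIV] intro!: tensor_in_supp_space e_closed)

lemma \<Phi>_basis: "i < p * s \<Longrightarrow> j < t * s \<Longrightarrow> \<Phi> (mon i j) = Poly_Mapping.single (i, j) 1"
  by (simp add: \<Phi>_mon V_x_funpow)

lemma \<gamma>_\<Phi>_mon:
  "g \<in> carrier G \<Longrightarrow> T.\<gamma> g (\<Phi> (mon i j)) = scale (\<chi> g ^ (i + j) * \<sigma> g * \<mu> g) (\<Phi> (mon i j))"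
  by (simp add: \<Phi>_mon T.\<gamma>_tensor V_grp_funpow[OF \<sigma> _ p] V_grp_funpow[OF \<mu> _ t]
      tensor_scale_left tensor_scale_right power_add mult_ac)

text \<open>The coefficient depends on j, so x does not act as multiplication by a fixed
  polynomial.\<close>

lemma \<psi>_\<Phi>_mon:
  "T.\<psi> (\<Phi> (mon i j)) = scale (\<chi> a ^ j * \<mu> a) (\<Phi> (mon (Suc i) j)) + \<Phi> (mon i (Suc j))"
  by (simp add: \<Phi>_mon T.\<psi>_tensor V_grp_funpow[OF \<mu> a_carrier t] tensor_scale_right)

definition c :: 'k where "c = \<mu> a ^ s"

lemma c_nonzero: "c \<noteq> 0"
  using carrier_character_groupD(2)[OF \<mu> a_carrier a_carrier] by (simp add: c_def)

definition Z :: "nat \<times> nat \<Rightarrow>\<^sub>0 'k" where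
  "Z = scale c (mon s 0) + mon 0 s"

text \<open>The q-binomial theorem leaves the s-th powers of the two summands. The first one
  contributes (\<chi>(a)^j \<mu>(a))^s = \<mu>(a)^s, now independent of j, so the result is
  multiplication by one polynomial.\<close>

lemma \<psi>_funpow_s_\<Phi>: "(T.\<psi> ^^ s) (\<Phi> f) = \<Phi> (Z * f)"
proof (rule mon_eqI[where f = "\<lambda>f. (T.\<psi> ^^ s) (\<Phi> f)" and g = "\<lambda>f. \<Phi> (Z * f)"])
  show "linmap (\<lambda>f. (T.\<psi> ^^ s) (\<Phi> f))" "linmap (\<lambda>f. \<Phi> (Z * f))"
    by (intro linmap_compose[OF linmap_funpow[OF T.linmap_\<psi>]] linmap_\<Phi>
        linmap_compose[OF linmap_\<Phi> linmap_mult_left])+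
  fix i j
  define U where "U = tensor_map X (V_grp \<chi> \<mu> a)"
  define W where "W = tensor_map (\<lambda>v :: nat \<Rightarrow>\<^sub>0 'k. v) Y"
  note lin = linmap_V_x linmap_V_grp linmap_id
  have U_tensor: "U (tensor u v) = tensor (X u) (V_grp \<chi> \<mu> a v)" for u v
    unfolding U_def by (intro tensor_map_tensor lin)
  have W_tensor: "W (tensor u v) = tensor u (Y v)" for u v
    unfolding W_def by (intro tensor_map_tensor lin)
  have linU: "linmap U" and linW: "linmap W" by (simp_all add: U_def W_def)
  have sp: "Poly_Mapping.single i 1 \<in> space (V G \<chi> p \<sigma> \<alpha>)" if "i < p * s" for i
    using that by (simp add: space_V)
  have sp': "Poly_Mapping.single i 1 \<in> space (V G \<chi> t \<mu> \<beta>)" if "i < t * s" for i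
    using that by (simp add: space_V)
  have U_closed: "U w \<in> space T.MN" if "w \<in> space T.MN" for w
    by (rule linmap_in_subspace[OF linU subspace_space that[unfolded space_MN]])
       (auto simp: space_MN U_def tensor_map_single simp del: tensor_single intro!: tensor_in_supp_space
         T.M.\<psi>_closed[OF sp, unfolded space_V] T.N.\<gamma>_closed[OF a_carrier sp', unfolded space_V])
  have W_closed: "W w \<in> space T.MN" if "w \<in> space T.MN" for w
    by (rule linmap_in_subspace[OF linW subspace_space that[unfolded space_MN]])
       (auto simp: space_MN W_def tensor_map_single simp del: tensor_single intro!: tensor_in_supp_space
         T.N.\<psi>_closed[OF sp', unfolded space_V])
  \<comment> \<open>The operators meet only in the second factor, as the action of a and as
    \<open>Y\<close>. The rule for moving x past a, read backwards, gives the ratio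
    \<open>\<chi> a\<close>.\<close>
  have comm: "U (W w) = scale (\<chi> a) (W (U w))" if "w \<in> space T.MN" for w
  proof (rule linmap_eq_on_tensor[OF linmap_compose[OF linU linW] linmap_scaled[OF linmap_compose[OF linW linU]]
        that[unfolded space_MN]])
    fix i j assume j: "j \<in> {..<t * s}"
    have "Y (V_grp \<chi> \<mu> a (Poly_Mapping.single j 1)) = scale (\<eta> a) (V_grp \<chi> \<mu> a (Y (Poly_Mapping.single j 1)))"
      by (rule T.N.\<psi>_\<gamma>[OF a_carrier sp']) (use j in simp)
    moreover have "\<chi> a * \<eta> a = 1"
      using \<chi>_nonzero[OF a_carrier] by (simp add: \<eta>_inverse[OF a_carrier])
    ultimately show "U (W (tensor (Poly_Mapping.single i 1) (Poly_Mapping.single j 1)))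
      = scale (\<chi> a) (W (U (tensor (Poly_Mapping.single i 1) (Poly_Mapping.single j 1))))"
      by (simp add: U_tensor W_tensor tensor_scale_right del: tensor_single V_grp_single)
  qed
  have U_pow: "(U ^^ n) (\<Phi> (mon i j)) = scale ((\<chi> a ^ j * \<mu> a) ^ n) (\<Phi> (mon (i + n) j))" for n
    by (induction n) (simp_all add: \<Phi>_mon linmap_scale[OF linU] U_tensor V_grp_funpow[OF \<mu> a_carrier t]
        tensor_scale_right mult.commute)
  have W_pow: "(W ^^ n) (\<Phi> (mon i j)) = \<Phi> (mon i (j + n))" for n
    by (induction n) (simp_all add: \<Phi>_mon W_tensor)
  have "(\<chi> a ^ j) ^ s = (\<chi> a ^ s) ^ j"
    by (simp add: power_mult[symmetric] mult.commute)
  then have cs: "(\<chi> a ^ j * \<mu> a) ^ s = c"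
    by (simp add: power_mult_distrib c_def \<chi>_pow_s[OF a_carrier])
  have \<psi>_eq: "T.\<psi> = (\<lambda>w. U w + W w)"
    by (rule ext) (simp only: T.\<psi>_def U_def W_def)
  have "(T.\<psi> ^^ s) (\<Phi> (mon i j)) = ((\<lambda>w. U w + W w) ^^ s) (\<Phi> (mon i j))"
    by (simp only: \<psi>_eq)
  also have "\<dots> = (U ^^ s) (\<Phi> (mon i j)) + (W ^^ s) (\<Phi> (mon i j))"
    by (rule q_binomial_root_of_unity[OF linU linW U_closed W_closed comm \<Phi>_closed root_\<chi>])
  also have "(U ^^ s) (\<Phi> (mon i j)) = scale c (\<Phi> (mon (i + s) j))"
    by (simp only: U_pow cs)
  also have "scale c (\<Phi> (mon (i + s) j)) + (W ^^ s) (\<Phi> (mon i j)) = \<Phi> (Z * mon i j)"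
    by (simp add: W_pow Z_def distrib_right scale_mult mon_mult linmap_add[OF linmap_\<Phi>]
        linmap_scale[OF linmap_\<Phi>] add.commute)
  finally show "(T.\<psi> ^^ s) (\<Phi> (mon i j)) = \<Phi> (Z * mon i j)" .
qed

lemma \<psi>_funpow_mult_s_\<Phi>: "(T.\<psi> ^^ (n * s)) (\<Phi> f) = \<Phi> (Z ^ n * f)"
  by (induction n arbitrary: f) (simp_all add: funpow_add \<psi>_funpow_s_\<Phi> mult_ac)

text \<open>The factor \<open>c\<close> is absorbed into \<open>u\<close> so that
  \<open>u + v\<close> becomes \<open>Z\<close> minus a constant. That constant
  \<open>z\<^sub>0\<close> is the parameter of every summand.\<close>

definition u :: "nat \<times> nat \<Rightarrow>\<^sub>0 'k" where
  "u = scale c (mon s 0 - Poly_Mapping.single 0 \<alpha>)"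

definition v :: "nat \<times> nat \<Rightarrow>\<^sub>0 'k" where
  "v = mon 0 s - Poly_Mapping.single 0 \<beta>"

definition z\<^sub>0 :: 'k where "z\<^sub>0 = \<alpha> * \<mu> a ^ s + \<beta>"

lemma u_plus_v: "u + v = Z - Poly_Mapping.single 0 z\<^sub>0"
  by (simp add: u_def v_def Z_def z\<^sub>0_def c_def pm.scale_right_diff_distrib single_add mult.commute)

lemma mult_eq_0I:
  assumes "\<And>i j. \<Phi> (h * mon i j) = 0"
  shows "\<Phi> (h * f) = 0"
  by (rule mon_eqI[where f = "\<lambda>f. \<Phi> (h * f)" and g = "\<lambda>f. 0"])
     (use assms in \<open>auto intro: linmap_compose[OF linmap_\<Phi> linmap_mult_left] linmapI\<close>)

lemma \<Phi>_u_pow: "\<Phi> (u ^ p * f) = 0"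
proof (rule mult_eq_0I)
  fix i j
  have "u ^ p = scale (c ^ p) ((mon s 0 - Poly_Mapping.single 0 \<alpha>) ^ p)"
    unfolding u_def by (induction p) (simp_all add: scale_mult)
  also have "\<dots> = scale (c ^ p) (mon (s * p) 0 - (\<Sum>j<p. scale (V_coeff p \<alpha> j) (mon (s * j) 0)))"
    by (simp add: power_diff_const_expand mon_power)
  finally have "\<Phi> (u ^ p * mon i j)
    = scale (c ^ p) (\<Phi> (mon (s * p + i) j) - (\<Sum>l<p. scale (V_coeff p \<alpha> l) (\<Phi> (mon (s * l + i) j))))"
    by (simp add: scale_mult left_diff_distrib sum_distrib_right mon_mult linmap_scale[OF linmap_\<Phi>]
        linmap_diff[OF linmap_\<Phi>] linmap_sum[OF linmap_\<Phi>])
  \<comment> \<open>The relation x^(ps) m_0 = \<Sum> \<alpha>_l x^(ls) m_0, shifted by x^i in the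
    first tensor factor.\<close>
  also have "\<Phi> (mon (s * p + i) j) = (\<Sum>l<p. scale (V_coeff p \<alpha> l) (\<Phi> (mon (s * l + i) j)))"
  proof -
    have "e\<^sub>1 (s * p + i) = (X ^^ i) (e\<^sub>1 (p * s))"
      by (simp add: funpow_add[symmetric, THEN fun_cong, simplified] add.commute mult.commute)
    also have "\<dots> = (\<Sum>l<p. scale (V_coeff p \<alpha> l) (e\<^sub>1 (s * l + i)))"
      using p s by (subst V_x_funpow_top)
        (simp_all add: linmap_sum[OF linmap_funpow[OF linmap_V_x]] linmap_scale[OF linmap_funpow[OF linmap_V_x]]
          funpow_add[symmetric, THEN fun_cong, simplified] add.commute mult.commute)
    finally show ?thesis
      by (simp add: \<Phi>_mon linmap_sum[OF linmap_tensor_left] tensor_scale_left)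
  qed
  finally show "\<Phi> (u ^ p * mon i j) = 0" by simp
qed

lemma \<Phi>_v_pow: "\<Phi> (v ^ t * f) = 0"
proof (rule mult_eq_0I)
  fix i j
  have "v ^ t = mon 0 (s * t) - (\<Sum>j<t. scale (V_coeff t \<beta> j) (mon 0 (s * j)))"
    by (simp add: v_def power_diff_const_expand mon_power)
  then have "\<Phi> (v ^ t * mon i j)
    = \<Phi> (mon i (s * t + j)) - (\<Sum>l<t. scale (V_coeff t \<beta> l) (\<Phi> (mon i (s * l + j))))"
    by (simp add: scale_mult left_diff_distrib sum_distrib_right mon_mult linmap_scale[OF linmap_\<Phi>]
        linmap_diff[OF linmap_\<Phi>] linmap_sum[OF linmap_\<Phi>])
  also have "\<Phi> (mon i (s * t + j)) = (\<Sum>l<t. scale (V_coeff t \<beta> l) (\<Phi> (mon i (s * l + j))))"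
  proof -
    have "e\<^sub>2 (s * t + j) = (Y ^^ j) (e\<^sub>2 (t * s))"
      by (simp add: funpow_add[symmetric, THEN fun_cong, simplified] add.commute mult.commute)
    also have "\<dots> = (\<Sum>l<t. scale (V_coeff t \<beta> l) (e\<^sub>2 (s * l + j)))"
      using t s by (subst V_x_funpow_top)
        (simp_all add: linmap_sum[OF linmap_funpow[OF linmap_V_x]] linmap_scale[OF linmap_funpow[OF linmap_V_x]]
          funpow_add[symmetric, THEN fun_cong, simplified] add.commute mult.commute)
    finally show ?thesis
      by (simp add: \<Phi>_mon linmap_sum[OF linmap_tensor_right] tensor_scale_right)
  qed
  finally show "\<Phi> (v ^ t * mon i j) = 0" by simp
qed

end

section \<open>Generators of the direct summands\<close>

context tensor_V
begin

abbreviation "m \<equiv> min p t"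

definition blk :: "nat \<Rightarrow> nat" where
  "blk j = 2 * j - 1 + nat \<bar>int p - int t\<bar>"

text \<open>The summand with index j is generated in degree d = m - j, which turns p + t - 1 - 2d
  into 2j - 1 + |p - t|.\<close>

definition gen :: "nat \<Rightarrow> nat \<times> nat \<Rightarrow>\<^sub>0 'k" where
  "gen j = cg_elem p t (m - j) u v"

definition w :: "nat \<Rightarrow> nat \<Rightarrow> (nat \<times> nat \<Rightarrow>\<^sub>0 'k)" where
  "w i j = \<Phi> (gen j * mon i 0)"

lemma blk_eq: "j \<in> {1..m} \<Longrightarrow> blk j = p + t - 1 - 2 * (m - j)"
  by (auto simp: blk_def min_def)

lemma blk_pos: "j \<in> {1..m} \<Longrightarrow> blk j > 0"
  by (auto simp: blk_def)

lemma \<Phi>_ideal: "\<Phi> ((u ^ p * f + v ^ t * g) * h) = 0"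
proof -
  have "(u ^ p * f + v ^ t * g) * h = u ^ p * (f * h) + v ^ t * (g * h)"
    by (simp add: algebra_simps)
  then show ?thesis by (simp add: linmap_add[OF linmap_\<Phi>] \<Phi>_u_pow \<Phi>_v_pow)
qed

text \<open>The power (u + v)^(blk j) moves the generator into the ideal of u^p and v^t, which
  \<Phi> kills. As u + v is \<open>Z\<close> minus \<open>z\<^sub>0\<close> and \<open>Z\<close>
  acts as x^s, expanding the power gives the relation requested by
  \<open>lin_funpow_V_x\<close>.\<close>

lemma \<psi>_funpow_w:
  assumes j: "j \<in> {1..m}"
  shows "(T.\<psi> ^^ (blk j * s)) (w i j)
    = (\<Sum>l<blk j. scale (V_coeff (blk j) z\<^sub>0 l) ((T.\<psi> ^^ (l * s)) (w i j)))"
proof -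
  have "m - j < p" "m - j < t" using j p t by auto
  then obtain f g where "(u + v) ^ blk j * gen j = u ^ p * f + v ^ t * g"
    using cg_elem_annihilated[of "m - j" p t u v] unfolding blk_eq[OF j] gen_def by blast
  then have "\<Phi> ((u + v) ^ blk j * (gen j * mon i 0)) = 0"
    using \<Phi>_ideal[of f g "mon i 0"] by (simp add: mult.assoc[symmetric])
  then have "\<Phi> (Z ^ blk j * (gen j * mon i 0))
    - (\<Sum>l<blk j. scale (V_coeff (blk j) z\<^sub>0 l) (\<Phi> (Z ^ l * (gen j * mon i 0)))) = 0"
    unfolding u_plus_v power_diff_const_expand
    by (simp add: left_diff_distrib sum_distrib_right scale_mult linmap_diff[OF linmap_\<Phi>]
        linmap_sum[OF linmap_\<Phi>] linmap_scale[OF linmap_\<Phi>])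
  then show ?thesis by (simp add: \<psi>_funpow_mult_s_\<Phi> w_def)
qed

text \<open>The subalgebra k[x_1^s, x_2^s]. Since \<chi>^s = 1, the group acts on its image under
  \<Phi> through the single character \<sigma>\<mu>, so the generators lying in it are
  eigenvectors.\<close>

definition wt_0 :: "(nat \<times> nat \<Rightarrow>\<^sub>0 'k) set" where
  "wt_0 = supp_space {(k, l). s dvd k \<and> s dvd l}"

lemma wt_0_mult: "f \<in> wt_0 \<Longrightarrow> g \<in> wt_0 \<Longrightarrow> f * g \<in> wt_0"
  using keys_mult[of f g] by (fastforce simp: wt_0_def supp_space_def)

lemma wt_0_add: "f \<in> wt_0 \<Longrightarrow> g \<in> wt_0 \<Longrightarrow> f + g \<in> wt_0"
  and wt_0_scale: "f \<in> wt_0 \<Longrightarrow> scale b f \<in> wt_0"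
  and wt_0_uminus: "f \<in> wt_0 \<Longrightarrow> - f \<in> wt_0"
  and wt_0_diff: "f \<in> wt_0 \<Longrightarrow> g \<in> wt_0 \<Longrightarrow> f - g \<in> wt_0"
  and wt_0_0: "0 \<in> wt_0"
  by (simp_all add: wt_0_def pm.subspace_diff[OF subspace_supp_space])

lemma wt_0_const: "Poly_Mapping.single 0 b \<in> wt_0"
  by (simp add: wt_0_def supp_space_def zero_prod_def)

lemma wt_0_1: "1 \<in> wt_0"
  unfolding single_one[symmetric] by (rule wt_0_const)

lemma wt_0_power: "f \<in> wt_0 \<Longrightarrow> f ^ n \<in> wt_0"
  by (induction n) (auto intro: wt_0_mult wt_0_1)

lemma wt_0_of_nat: "of_nat n \<in> wt_0"
  by (induction n) (auto intro: wt_0_add wt_0_1 wt_0_0)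

lemma wt_0_u: "u \<in> wt_0" and wt_0_v: "v \<in> wt_0"
proof -
  have "mon s 0 \<in> wt_0" "mon 0 s \<in> wt_0" by (simp_all add: mon_def wt_0_def)
  then show "u \<in> wt_0" "v \<in> wt_0"
    by (auto simp: u_def v_def intro!: wt_0_scale wt_0_diff wt_0_const)
qed

lemma wt_0_gen: "gen j \<in> wt_0"
  unfolding gen_def cg_elem_def
proof (rule pm.subspace_sum)
  show "pm.subspace wt_0" by (simp add: wt_0_def)
qed (intro wt_0_mult wt_0_power wt_0_of_nat wt_0_uminus wt_0_1 wt_0_u wt_0_v)

lemma \<gamma>_w:
  assumes g: "g \<in> carrier G"
  shows "T.\<gamma> g (w i j) = scale (\<chi> g ^ i * \<sigma> g * \<mu> g) (w i j)"
  unfolding w_def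
proof (rule linmap_eq_on[where f = "\<lambda>f. T.\<gamma> g (\<Phi> (f * mon i 0))"
      and g = "\<lambda>f. scale (\<chi> g ^ i * \<sigma> g * \<mu> g) (\<Phi> (f * mon i 0))", OF _ _ wt_0_gen[unfolded wt_0_def]])
  have "linmap (\<lambda>f. \<Phi> (f * mon i 0))"
    using linmap_compose[OF linmap_\<Phi> linmap_mult_left[of "mon i 0"]] by (simp add: mult.commute)
  then show "linmap (\<lambda>f. T.\<gamma> g (\<Phi> (f * mon i 0)))"
    "linmap (\<lambda>f. scale (\<chi> g ^ i * \<sigma> g * \<mu> g) (\<Phi> (f * mon i 0)))"
    by (rule linmap_compose[OF T.linmap_\<gamma>], rule linmap_scaled)
  fix b assume "b \<in> {(k, l). s dvd k \<and> s dvd l}"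
  then obtain k l where b: "b = (s * k, s * l)" by (auto elim!: dvdE)
  have "\<chi> g ^ (s * n) = 1" for n by (simp add: power_mult \<chi>_pow_s[OF g])
  then have "\<chi> g ^ (s * k + i + s * l) = \<chi> g ^ i" by (simp add: power_add)
  then show "T.\<gamma> g (\<Phi> (Poly_Mapping.single b 1 * mon i 0))
    = scale (\<chi> g ^ i * \<sigma> g * \<mu> g) (\<Phi> (Poly_Mapping.single b 1 * mon i 0))"
    unfolding b mon_def[symmetric] mon_mult by (simp add: \<gamma>_\<Phi>_mon[OF g])
qed

lemma w_closed: "w i j \<in> space T.MN"
  by (simp add: w_def \<Phi>_closed)

definition ch :: "nat \<Rightarrow> 'g \<Rightarrow> 'k" where
  "ch i = \<chi> [^]\<^bsub>character_group G\<^esub> i \<otimes>\<^bsub>character_group G\<^esub> \<sigma> \<otimes>\<^bsub>character_group G\<^esub> \<mu>"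

lemma ch_carrier: "ch i \<in> carrier (character_group G)"
  unfolding ch_def using \<chi> \<sigma> \<mu> by simp

lemma ch_eq: "g \<in> carrier G \<Longrightarrow> ch i g = \<chi> g ^ i * \<sigma> g * \<mu> g"
  by (simp add: ch_def mult_character_group pow_character_group)

section \<open>The map from the direct sum to the tensor product\<close>

definition DS :: "('g \<times> nat \<Rightarrow>\<^sub>0 'k, nat \<times> nat \<times> nat, 'k) based_module" where
  "DS = direct_sum {0..s - 1} (\<lambda>i. direct_sum {1..m} (\<lambda>j. V G \<chi> (blk j) (ch i) z\<^sub>0))"

abbreviation "\<gamma>' g \<equiv> sum_map (\<lambda>i. sum_map (\<lambda>j. V_grp \<chi> (ch i) g))"
abbreviation "\<psi>' \<equiv> sum_map (\<lambda>i. sum_map (\<lambda>j. V_x s (blk j) z\<^sub>0))"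

sublocale D: H_rep G \<eta> DS \<gamma>' \<psi>'
  unfolding DS_def by (intro H_rep_direct_sum rep_V ch_carrier)

definition DB :: "(nat \<times> nat \<times> nat) set" where
  "DB = Sigma {0..s - 1} (\<lambda>i. Sigma {1..m} (\<lambda>j. {..<blk j * s}))"

lemma basis_DS: "basis DS = DB"
  by (simp add: DS_def DB_def direct_sum_def basis_V)

lemma space_DS: "space DS = supp_space DB"
  by (simp add: space_eq basis_DS)

definition cg_map :: "(nat \<times> nat \<times> nat \<Rightarrow>\<^sub>0 'k) \<Rightarrow> (nat \<times> nat \<Rightarrow>\<^sub>0 'k)" where
  "cg_map = lin (\<lambda>(i, j, l). (T.\<psi> ^^ l) (w i j))"

lemma linmap_cg_map [simp]: "linmap cg_map"
  by (simp add: cg_map_def)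

lemma cg_map_incl: "cg_map (incl i (incl j x)) = lin (\<lambda>l. (T.\<psi> ^^ l) (w i j)) x"
  by (rule linmap_eqI[where f = "\<lambda>x. cg_map (incl i (incl j x))"])
     (auto simp: cg_map_def intro!: linmap_compose[OF linmap_lin linmap_compose[OF linmap_incl linmap_incl]])

lemma cg_map_\<psi>:
  assumes x: "x \<in> space DS"
  shows "cg_map (\<psi>' x) = T.\<psi> (cg_map x)"
proof (rule linmap_eq_on[OF linmap_compose[OF linmap_cg_map linmap_sum_map]
      linmap_compose[OF T.linmap_\<psi> linmap_cg_map] x[unfolded space_DS DB_def]], clarify)
  fix i j l assume j: "j \<in> {1..m}" and l: "l < blk j * s"
  have "cg_map (\<psi>' (incl i (incl j (Poly_Mapping.single l 1))))
    = cg_map (incl i (incl j (V_x s (blk j) z\<^sub>0 (Poly_Mapping.single l 1))))"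
    by (simp only: sum_map_incl linmap_sum_map linmap_V_x)
  also have "\<dots> = T.\<psi> ((T.\<psi> ^^ l) (w i j))"
    unfolding cg_map_incl by (rule lin_funpow_V_x[OF l \<psi>_funpow_w[OF j]])
  also have "(T.\<psi> ^^ l) (w i j) = cg_map (incl i (incl j (Poly_Mapping.single l 1)))"
    unfolding cg_map_incl by simp
  finally show "cg_map (\<psi>' (Poly_Mapping.single (i, j, l) 1)) = T.\<psi> (cg_map (Poly_Mapping.single (i, j, l) 1))"
    by simp
qed

lemma cg_map_\<gamma>:
  assumes g: "g \<in> carrier G" and x: "x \<in> space DS"
  shows "cg_map (\<gamma>' g x) = T.\<gamma> g (cg_map x)"
proof (rule linmap_eq_on[OF linmap_compose[OF linmap_cg_map linmap_sum_map]
      linmap_compose[OF T.linmap_\<gamma> linmap_cg_map] x[unfolded space_DS DB_def]], clarify)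
  fix i j l assume j: "j \<in> {1..m}" and l: "l < blk j * s"
  let ?w = "(T.\<psi> ^^ l) (w i j)"
  \<comment> \<open>Computing the action of g below x^l in two ways determines it above x^l, once
    the factor \<eta>(g)^l is inverted by \<chi>(g)^l.\<close>
  have "scale (ch i g) ?w = (T.\<psi> ^^ l) (T.\<gamma> g (w i j))"
    by (simp add: \<gamma>_w[OF g] ch_eq[OF g] linmap_scale[OF linmap_funpow[OF T.linmap_\<psi>]])
  also have "\<dots> = scale (\<eta> g ^ l) (T.\<gamma> g ?w)"
    by (rule \<psi>_funpow_\<gamma>[OF g w_closed])
  finally have "scale (\<chi> g ^ l) (scale (ch i g) ?w) = scale (\<chi> g ^ l * \<eta> g ^ l) (T.\<gamma> g ?w)"
    by simp
  also have "\<chi> g ^ l * \<eta> g ^ l = 1"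
    using \<chi>_nonzero[OF g] by (simp add: \<eta>_inverse[OF g] power_mult_distrib[symmetric])
  finally have *: "T.\<gamma> g ?w = scale (\<chi> g ^ l * ch i g) ?w" by simp
  have "cg_map (\<gamma>' g (incl i (incl j (Poly_Mapping.single l 1))))
    = cg_map (incl i (incl j (V_grp \<chi> (ch i) g (Poly_Mapping.single l 1))))"
    by (simp only: sum_map_incl linmap_sum_map linmap_V_grp)
  also have "\<dots> = scale (\<chi> g ^ l * ch i g) ?w"
    unfolding cg_map_incl by simp
  also have "\<dots> = T.\<gamma> g (cg_map (incl i (incl j (Poly_Mapping.single l 1))))"
    unfolding cg_map_incl by (simp add: *)
  finally show "cg_map (\<gamma>' g (Poly_Mapping.single (i, j, l) 1)) = T.\<gamma> g (cg_map (Poly_Mapping.single (i, j, l) 1))"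
    by simp
qed

lemma cg_map_closed: "x \<in> space DS \<Longrightarrow> cg_map x \<in> space T.MN"
  unfolding space_DS DB_def cg_map_def
  by (erule lin_in_subspace[OF subspace_space]) (auto intro: \<psi>_funpow_closed w_closed)

section \<open>Surjectivity\<close>

definition Im :: "(nat \<times> nat \<Rightarrow>\<^sub>0 'k) set" where
  "Im = {f. \<Phi> f \<in> cg_map ` space DS}"

lemma subspace_Im: "pm.subspace Im"
  using subspace_linmap_vimage[OF linmap_\<Phi> subspace_linmap_image[OF linmap_cg_map subspace_space[of DS]]]
  by (simp add: Im_def vimage_def)

lemmas Im_add = pm.subspace_add[OF subspace_Im]
  and Im_diff = pm.subspace_diff[OF subspace_Im]
  and Im_scale = pm.subspace_scale[OF subspace_Im]
  and Im_sum = pm.subspace_sum[OF subspace_Im]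

lemma \<psi>_image: "y \<in> cg_map ` space DS \<Longrightarrow> T.\<psi> y \<in> cg_map ` space DS"
  using D.\<psi>_closed by (auto simp: cg_map_\<psi>[symmetric])

text \<open>The image is pulled back to the polynomial ring so that \<open>u\<close> and
  \<open>v\<close> can be multiplied there. The image is stable under x, hence under x^s, and x^s is
  multiplication by \<open>Z\<close>.\<close>

lemma Im_Z: "f \<in> Im \<Longrightarrow> Z * f \<in> Im"
proof -
  assume "f \<in> Im"
  then have "(T.\<psi> ^^ n) (\<Phi> f) \<in> cg_map ` space DS" for n
    by (induction n) (auto simp: Im_def intro: \<psi>_image)
  from this[of s] show "Z * f \<in> Im" by (simp only: Im_def \<psi>_funpow_s_\<Phi> mem_Collect_eq)
qed

lemma Im_u_plus_v:
  assumes "f \<in> Im"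
  shows "(u + v) * f \<in> Im"
proof -
  have "(u + v) * f = Z * f - scale z\<^sub>0 f"
    unfolding u_plus_v by (simp add: left_diff_distrib scale_eq_mult)
  then show ?thesis using assms by (simp add: Im_diff Im_Z Im_scale)
qed

lemma Im_gen:
  assumes "i < s" "d < m"
  shows "cg_elem p t d u v * mon i 0 \<in> Im"
proof -
  have j: "m - d \<in> {1..m}" using assms by auto
  \<comment> \<open>Inverts the indexing d = m - j; the last index 0 selects the generator m_0 of
    the summand.\<close>
  let ?x = "Poly_Mapping.single (i, m - d, 0) (1 :: 'k)"
  have "?x \<in> space DS" using assms j blk_pos[OF j] s unfolding space_DS DB_def by auto
  moreover have "cg_map ?x = \<Phi> (cg_elem p t d u v * mon i 0)"
    using assms by (simp add: cg_map_def w_def gen_def)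
  ultimately show ?thesis unfolding Im_def by (metis (mono_tags) imageI mem_Collect_eq)
qed

lemma Im_ideal: "u ^ p * f \<in> Im" "v ^ t * f \<in> Im"
  using linmap_0[OF linmap_cg_map] pm.subspace_0[OF subspace_space[of DS]]
  by (auto simp: Im_def \<Phi>_u_pow \<Phi>_v_pow intro!: image_eqI[of _ _ 0])

text \<open>Modulo \<open>u + v\<close> the quotient algebra is spanned by powers of \<open>v\<close>, so Nakayama's argument
  needs only that each generator has a nonzero coefficient there.\<close>

lemma Im_u_v:
  assumes i: "i < s"
  shows "e + f = k \<Longrightarrow> u ^ e * v ^ f * mon i 0 \<in> Im"
proof (induction k arbitrary: e f rule: less_induct)
  case (less k)
  \<comment> \<open>Modulo \<open>Im\<close> a factor u may be traded for -v in total degree k: (u +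
    v) times a monomial of degree k - 1 lies in \<open>Im\<close> by the outer induction.\<close>
  have congr: "u ^ e * v ^ (k - e) * mon i 0 - scale ((-1) ^ e) (v ^ k * mon i 0) \<in> Im" if "e \<le> k" for e
    using that
  proof (induction e)
    case 0
    then show ?case by (simp add: pm.subspace_0[OF subspace_Im])
  next
    case (Suc e)
    have k: "k - e = Suc (k - Suc e)" using Suc.prems by simp
    have "u ^ e * v ^ (k - Suc e) * mon i 0 \<in> Im"
      using less.IH[of "k - 1" e "k - Suc e"] Suc.prems by simp
    from Im_diff[OF Im_u_plus_v[OF this] Suc.IH[OF Suc_leD[OF Suc.prems]]]
    show ?case
      unfolding k by (simp add: algebra_simps)
  qed
  have top: "v ^ k * mon i 0 \<in> Im"
  proof -
    \<comment> \<open>In degree at least t or at least p the ideal supplies an element (in the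
      second case u^k, equal to v^k up to sign modulo \<open>Im\<close>); in every degree below min
      p t there is a generator.\<close>
    consider "k \<ge> t" | "k \<ge> p" | "k < m" by linarith
    then show ?thesis
    proof cases
      case 1
      then have "v ^ k = v ^ t * v ^ (k - t)" by (metis le_add_diff_inverse power_add)
      then show ?thesis using Im_ideal(2) by (simp add: mult.assoc)
    next
      case 2
      then have "u ^ k = u ^ p * u ^ (k - p)" by (metis le_add_diff_inverse power_add)
      then have "u ^ k * mon i 0 \<in> Im" using Im_ideal(1) by (simp add: mult.assoc)
      from Im_scale[OF Im_diff[OF this congr[of k, simplified]], of "(-1) ^ k"]
      show ?thesis by (simp add: power_mult_distrib[symmetric])
    next
      case 3
      let ?a = "\<lambda>i. cg_coeff p t k i"
      have sgn: "(-1 :: nat \<times> nat \<Rightarrow>\<^sub>0 'k) ^ l * (of_nat b * x) = scale ((-1) ^ l * of_nat b) x" for l b x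
        by (induction l) (simp_all add: scale_eq_mult single_of_nat single_uminus)
      have "cg_elem p t k u v * mon i 0 = (\<Sum>l\<le>k. scale ((-1) ^ l * of_nat (?a l)) (u ^ l * v ^ (k - l) * mon i 0))"
        unfolding cg_elem_def sum_distrib_right
        by (intro sum.cong refl) (simp add: sgn mult.assoc scale_mult)
      \<comment> \<open>The alternating signs of the generator cancel those from trading u for -v,
        so v^k appears with a sum of natural numbers.\<close>
      moreover have "(\<Sum>l\<le>k. scale ((-1) ^ l * of_nat (?a l)) (scale ((-1) ^ l) (v ^ k * mon i 0)))
        = scale (of_nat (\<Sum>l\<le>k. ?a l)) (v ^ k * mon i 0)"
        by (simp add: pm.scale_sum_left power_mult_distrib[symmetric] mult_ac)
      moreover have "(\<Sum>l\<le>k. scale ((-1) ^ l * of_nat (?a l)) (u ^ l * v ^ (k - l) * mon i 0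
          - scale ((-1) ^ l) (v ^ k * mon i 0))) \<in> Im"
        by (intro Im_sum Im_scale congr) simp
      ultimately have "cg_elem p t k u v * mon i 0 - scale (of_nat (\<Sum>l\<le>k. ?a l)) (v ^ k * mon i 0) \<in> Im"
        by (simp only: pm.scale_right_diff_distrib sum_subtractf)
      from Im_diff[OF Im_gen[OF i 3] this]
      have "scale (of_nat (\<Sum>l\<le>k. ?a l)) (v ^ k * mon i 0) \<in> Im" by simp
      from Im_scale[OF this, of "inverse (of_nat (\<Sum>l\<le>k. ?a l))"]
      have "scale (inverse (of_nat (\<Sum>l\<le>k. ?a l)) * of_nat (\<Sum>l\<le>k. ?a l)) (v ^ k * mon i 0) \<in> Im"
        by simp
      \<comment> \<open>The term l = 0 is a product of factorials, hence positive; characteristic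
        zero makes the sum invertible in the field.\<close>
      moreover have "(\<Sum>l\<le>k. ?a l) \<noteq> 0"
        by (auto simp: cg_coeff_def intro!: exI[of _ 0])
      then have "of_nat (\<Sum>l\<le>k. ?a l) \<noteq> (0 :: 'k)" by (simp only: of_nat_eq_0_iff not_False_eq_True)
      ultimately show ?thesis by (simp only: left_inverse pm.scale_one not_False_eq_True)
    qed
  qed
  have "e \<le> k" "f = k - e" using less.prems by auto
  from Im_add[OF congr[OF this(1)] Im_scale[OF top, of "(-1) ^ e"]] show ?case
    using \<open>f = k - e\<close> by simp
qed

text \<open>Induction on the exponent of x_2. For exponent 0 every power of x_1^s is a polynomial in
  u, as \<open>c\<close> is nonzero, and the remaining factor x_1^i has i < s. Higher exponents are
  produced by x, which may raise the exponent of x_1 instead, so k stays arbitrary.\<close>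

lemma Im_mon: "mon k l \<in> Im"
proof (induction l arbitrary: k)
  case 0
  \<comment> \<open>The power of u is general because each factor x_1^s splits into a multiple of u
    plus the constant \<alpha>.\<close>
  have *: "mon (s * q + i) 0 * u ^ e \<in> Im" if i: "i < s" for q e i
  proof (induction q arbitrary: e)
    case 0
    show ?case using Im_u_v[OF i, of e 0 e] by (simp add: mult.commute)
  next
    case (Suc q)
    have "mon (s * Suc q + i) 0 = mon s 0 * mon (s * q + i) 0"
      by (simp add: mon_mult add_ac)
    moreover have "mon s 0 = scale (inverse c) u + scale \<alpha> 1"
      using c_nonzero 
      by (simp add: u_def scale_eq_mult[of \<alpha>] pm.scale_right_diff_distrib mult.assoc[symmetric])
    ultimately have "mon (s * Suc q + i) 0 * u ^ e = (scale (inverse c) u + scale \<alpha> 1) * (mon (s * q + i) 0 * u ^ e)"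
      by (simp only: mult.assoc)
    also have "\<dots> = scale (inverse c) (mon (s * q + i) 0 * u ^ Suc e) + scale \<alpha> (mon (s * q + i) 0 * u ^ e)"
      unfolding distrib_right scale_mult by (simp add: mult_ac)
    finally show ?case using Suc.IH by (simp only: Im_add Im_scale)
  qed
  have "k = s * (k div s) + k mod s" by simp
  then show ?case using *[of "k mod s" "k div s" 0] s by simp
next
  case (Suc l)
  \<comment> \<open>Of the two terms of x applied to x_1^k x_2^l, the first lies in the image by the
    induction hypothesis at k + 1; subtracting it leaves the wanted monomial.\<close>
  have "\<Phi> (scale (\<chi> a ^ l * \<mu> a) (mon (Suc k) l) + mon k (Suc l)) = T.\<psi> (\<Phi> (mon k l))"
    by (simp add: \<psi>_\<Phi>_mon linmap_add[OF linmap_\<Phi>] linmap_scale[OF linmap_\<Phi>])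
  also have "\<dots> \<in> cg_map ` space DS" using Suc.IH[of k] by (intro \<psi>_image) (simp add: Im_def)
  finally have "scale (\<chi> a ^ l * \<mu> a) (mon (Suc k) l) + mon k (Suc l) \<in> Im" by (simp add: Im_def)
  from Im_diff[OF this Im_scale[OF Suc.IH[of "Suc k"], of "\<chi> a ^ l * \<mu> a"]] show ?case by simp
qed

lemma cg_map_image: "cg_map ` space DS = space T.MN"
proof
  show "cg_map ` space DS \<subseteq> space T.MN" using cg_map_closed by blast
  show "space T.MN \<subseteq> cg_map ` space DS"
  proof
    fix x assume "x \<in> space T.MN"
    then show "x \<in> cg_map ` space DS"
      unfolding space_MN
    proof (rule linmap_in_subspace[OF linmap_id subspace_linmap_image[OF linmap_cg_map subspace_space]], clarify)
      fix i j assume "i < p * s" "j < t * s"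
      then show "Poly_Mapping.single (i, j) 1 \<in> cg_map ` space DS"
        using Im_mon[of i j] by (simp add: Im_def \<Phi>_basis)
    qed
  qed
qed

lemma card_DB: "card DB = card ({..<p * s} \<times> {..<t * s})"
proof -
  \<comment> \<open>\<open>{0..s - 1}\<close> has s elements since s > 0.\<close>
  have "card DB = s * (\<Sum>j=1..m. blk j * s)"
    using s by (simp add: DB_def)
  also have "(\<Sum>j=1..m. blk j * s) = m * (m + nat \<bar>int p - int t\<bar>) * s"
    by (simp only: blk_def sum_distrib_right[symmetric] sum_block_sizes)
  also have "m + nat \<bar>int p - int t\<bar> = max p t" by auto
  also have "m * max p t = p * t" by (auto simp: min_def max_def)
  finally show ?thesis by (simp add: mult_ac)
qed

lemma bij_iso: "bij_betw cg_map (space DS) (space T.MN)"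
  using surj_imp_bij_supp_space[OF linmap_cg_map cg_map_image[unfolded space_DS space_MN] _ card_DB]
  by (simp add: space_DS space_MN DB_def)

lemma module_iso_DS: "module_iso (H_alg G \<eta>) T.MN DS"
  by (rule module_iso_of_H_reps[OF G ring H_rep_axioms D.H_rep_axioms linmap_cg_map bij_iso])
     (simp_all add: cg_map_\<gamma> cg_map_\<psi>)

end

theorem theorem3p7:
  fixes G :: "('g, 'm) monoid_scheme"
    and a :: 'g
    and \<chi> \<sigma> \<mu> :: "'g \<Rightarrow> 'k::{alg_closed_field, field_char_0}"
    and \<alpha> \<beta> :: 'k
    and p t s :: nat
  defines "Ghat \<equiv> (character_group G :: ('g \<Rightarrow> 'k) monoid)"
  defines "\<eta> \<equiv> inv\<^bsub>Ghat\<^esub> \<chi>"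
  assumes "group G"
    and "a \<in> center G"
    and "\<chi> \<in> carrier Ghat" and "\<chi> a \<noteq> 1"
    and "group.ord Ghat \<chi> = s" and "s > 0"
    and "primitive_root_of_unity s (\<eta> a)"
    and "p \<ge> 1" and "t \<ge> 1"
    and "\<sigma> \<in> carrier Ghat" and "\<mu> \<in> carrier Ghat"
    and "\<alpha> \<noteq> 0" and "\<beta> \<noteq> 0"
  shows "module_iso (H_alg G \<eta>)
     (tensor_module G \<eta> a (V G \<chi> p \<sigma> \<alpha>) (V G \<chi> t \<mu> \<beta>))
     (direct_sum {0..s - 1} (\<lambda>i. direct_sum {1..min p t} (\<lambda>j.
        V G \<chi> (2 * j - 1 + nat \<bar>int p - int t\<bar>)
          (\<chi> [^]\<^bsub>Ghat\<^esub> i \<otimes>\<^bsub>Ghat\<^esub> \<sigma> \<otimes>\<^bsub>Ghat\<^esub> \<mu>)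
          (\<alpha> * \<mu> a ^ s + \<beta>))))"
proof -
  interpret tensor_V G a \<chi> \<sigma> \<mu> \<alpha> \<beta> p t s \<eta>
    using assms by (intro tensor_V.intro) (simp_all add: Ghat_def \<eta>_def)
  show ?thesis
    using module_iso_DS unfolding DS_def ch_def blk_def z\<^sub>0_def Ghat_def .
qed

end
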